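(* Let $\lambda_0\in\mathbb{R}$ and let $g$ be any exchangeable prior distribution of $\tau_0$. A pseudo symmetric approximate design $d$ is ${\cal T}_{g,\lambda_0}$-optimal if and only if $q_d(x_d)+(t-2)q_d(\lambda_0)>0$ and $$\max_{s\in{\cal S}}\frac{q_s(x_d)+(t-2)q_s(\lambda_0)}{q_d(x_d)+(t-2)q_d(\lambda_0)}=1.$$ Moreover, in that case every sequence $s$ in the design $d$ (i.e. with $p_s>0$) attains this maximum.
   Context: Fix integers $p\ge2$ (periods), $t\ge2$ (treatments), $n\ge1$ (subjects) and a symmetric positive definite real $p\times p$ matrix $\Sigma$ (within-subject covariance). $1_k$ is the all-ones vector of length $k$, $J_k=1_k1_k'$, $B_k=I_k-J_k/k$, prime denotes transpose, and $\tilde B=\Sigma^{-1}-\Sigma^{-1}J_p\Sigma^{-1}/(1_p'\Sigma^{-1}1_p)$. Let ${\cal S}=\{1,\dots,t\}^p$ be the set of treatment sequences. For $s=(t_1,\dots,t_p)\in{\cal S}$, $T_s$ is the $p\times t$ matrix with $(k,i)$ entry $1$ if $t_k=i$ and $0$ otherwise; $F_s$ is the $p\times t$ matrix with zero first row and, for $k\ge2$, $(k,i)$ entry $1$ if $t_{k-1}=i$ and $0$ otherwise. An (approximate) design $d$ is a vector $P_d=(p_s)_{s\in{\cal S}}$ with $p_s\ge0$, $\sum_sp_s=1$. For $1\le i,j\le2$ put $\hat C_{sij}=B_tG_{s,i}'\tilde BG_{s,j}B_t$ with $G_{s,1}=T_s$, $G_{s,2}=F_s$, $\hat C_{dij}=n\sum_sp_s\hat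 C_{sij}$, $C_{dij}=\hat C_{dij}-nG_i'\tilde BG_j$ with $G_1=\sum_sp_sT_sB_t$, $G_2=\sum_sp_sF_sB_t$; $c_{sij}=\mathrm{tr}(\hat C_{sij})$, $c_{dij}=n\sum_sp_sc_{sij}$; $q_s(x)=c_{s11}+2c_{s12}x+c_{s22}x^2$, $q_d(x)=\sum_sp_sq_s(x)$, $x_d=-c_{d12}/c_{d22}$. A design $d$ is pseudo symmetric if all treatments are equally replicated in each period (for all $k,i$: the sum of $p_s$ over sequences $s$ with $t_k=i$ is $1/t$) and the matrices $C_{dij}$, $1\le i,j\le2$, are completely symmetric (of the form $aI_t+bJ_t$). In the proportional model (carryover effects equal $\lambda$ times direct effects $\tau$), Fisher's information matrix for $\tau$ at $(\tau_0,\lambda_0)$ is $C_{d,\tau_0,\lambda_0}(\tau)=C_{d11}+\lambda_0(C_{d12}+C_{d21})+\lambda_0^2C_{d22}-(C_{d12}+\lambda_0C_{d22})\tau_0(\tau_0'C_{d22}\tau_0)^{-1}\tau_0'(C_{d21}+\lambda_0C_{d22})$, the last term being $0$ if $\tau_0'C_{d22}\tau_0=0$. The prior $g$ is a probability distribution on $\{\tau_0\in\mathbb{R}^t:1_t'\tau_0=0,\ \tau_0\ne0\}$; it is exchangeable if invariant under all permutations of coordinates. For a $t\times t$ nonnegative definite matrix $C$ with zero row and column sums and eigenvalues $0=a_0\le a_1\le\dots\le a_{t-1}$, $\Phi_T(C)=(t-1)^{-1}\sum_{i=1}^{t-1}a_i$. ${\cal T}_{g,\lambda_0}(d)=\mathbb{E}_g[\Phi_T(C_{d,\tau_0,\lambda_0}(\tau))]$,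 and a design is ${\cal T}_{g,\lambda_0}$-optimal if it maximizes this over all approximate designs. *)

theory Defs
  imports
    "HOL-Probability.Probability"
    "HOL-Combinatorics.Permutations"
    "Jordan_Normal_Form.Char_Poly"
    "Jordan_Normal_Form.Gauss_Jordan_Elimination"
begin

text \<open>
  Conventions: matrices are those of \<open>Jordan_Normal_Form\<close>, with rows and columns indexed
  from 0. Accordingly periods are numbered \<open>0, ..., p - 1\<close> and treatments \<open>0, ..., t - 1\<close>.
  The names of several matrix operations also occur in \<open>HOL-Analysis\<close> and are therefore
  qualified below.
\<close>

section \<open>Matrices\<close>

definition ones_vec :: "nat \<Rightarrow> real Matrix.vec" where
  "ones_vec k = Matrix.vec k (\<lambda>_. 1)"

definition J_mat :: "nat \<Rightarrow> real Matrix.mat" where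
  "J_mat k = Matrix.mat k k (\<lambda>_. 1)"

definition B_mat :: "nat \<Rightarrow> real Matrix.mat" where
  "B_mat k = 1\<^sub>m k - (1 / real k) \<cdot>\<^sub>m J_mat k"

definition mat_trace :: "real Matrix.mat \<Rightarrow> real" where
  "mat_trace A = (\<Sum>i<dim_row A. A $$ (i, i))"

definition sym_pos_def :: "nat \<Rightarrow> real Matrix.mat \<Rightarrow> bool" where
  "sym_pos_def p A \<longleftrightarrow> A \<in> carrier_mat p p \<and> transpose_mat A = A \<and>
     (\<forall>v \<in> carrier_vec p. v \<noteq> 0\<^sub>v p \<longrightarrow> scalar_prod v (A *\<^sub>v v) > 0)"

definition completely_symmetric :: "nat \<Rightarrow> real Matrix.mat \<Rightarrow> bool" where
  "completely_symmetric t A \<longleftrightarrow> (\<exists>a b. A = a \<cdot>\<^sub>m 1\<^sub>m t + b \<cdot>\<^sub>m J_mat t)"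

text \<open>Real eigenvalues in increasing order, listed with algebraic multiplicity.\<close>

definition eigenvalues :: "real Matrix.mat \<Rightarrow> real list" where
  "eigenvalues A = sorted_list_of_multiset (proots (char_poly A))"

text \<open>
  Meant for a nonnegative definite \<open>t \<times> t\<close> matrix with zero row and column sums. Its
  eigenvalue list \<open>a\<close> has length \<open>t\<close> and \<open>a ! 0 = 0\<close>; this entry is left out of the sum.
\<close>

definition Phi_T :: "nat \<Rightarrow> real Matrix.mat \<Rightarrow> real" where
  "Phi_T t C = (\<Sum>i = 1..t - 1. eigenvalues C ! i) / (real t - 1)"

section \<open>Sequences and designs\<close>

definition seqs :: "nat \<Rightarrow> nat \<Rightarrow> nat list set" where
  "seqs p t = {s. length s = p \<and> set s \<subseteq> {..<t}}"

definition T_mat :: "nat \<Rightarrow> nat \<Rightarrow> nat list \<Rightarrow> real Matrix.mat" where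
  "T_mat p t s = Matrix.mat p t (\<lambda>(k, i). if s ! k = i then 1 else 0)"

definition F_mat :: "nat \<Rightarrow> nat \<Rightarrow> nat list \<Rightarrow> real Matrix.mat" where
  "F_mat p t s = Matrix.mat p t (\<lambda>(k, i). if k > 0 \<and> s ! (k - 1) = i then 1 else 0)"

definition is_design :: "nat \<Rightarrow> nat \<Rightarrow> (nat list \<Rightarrow> real) \<Rightarrow> bool" where
  "is_design p t P \<longleftrightarrow> (\<forall>s \<in> seqs p t. P s \<ge> 0) \<and> (\<Sum>s \<in> seqs p t. P s) = 1"

text \<open>The inverse of the within-subject covariance matrix exists because \<open>Cov\<close> is positive definite.\<close>

definition B_tilde :: "nat \<Rightarrow> real Matrix.mat \<Rightarrow> real Matrix.mat" where
  "B_tilde p Cov = (let V = the (mat_inverse Cov) in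
     V - (1 / scalar_prod (ones_vec p) (V *\<^sub>v ones_vec p)) \<cdot>\<^sub>m (V * J_mat p * V))"

text \<open>In the following the index \<open>i\<close> or \<open>j\<close> is 1 (direct effects) or 2 (carryover effects).\<close>

definition G_seq :: "nat \<Rightarrow> nat \<Rightarrow> nat list \<Rightarrow> nat \<Rightarrow> real Matrix.mat" where
  "G_seq p t s i = (if i = 1 then T_mat p t s else F_mat p t s)"

definition C_hat_seq ::
  "nat \<Rightarrow> nat \<Rightarrow> real Matrix.mat \<Rightarrow> nat list \<Rightarrow> nat \<Rightarrow> nat \<Rightarrow> real Matrix.mat" where
  "C_hat_seq p t Cov s i j =
     B_mat t * transpose_mat (G_seq p t s i) * B_tilde p Cov * G_seq p t s j * B_mat t"

text \<open>The \<open>r \<times> c\<close> matrix \<open>\<Sum>s. P s \<cdot> M s\<close> (matrices of unspecified size form no additive monoid).\<close>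

definition design_sum ::
  "nat \<Rightarrow> nat \<Rightarrow> (nat list \<Rightarrow> real) \<Rightarrow> nat \<Rightarrow> nat \<Rightarrow> (nat list \<Rightarrow> real Matrix.mat) \<Rightarrow> real Matrix.mat" where
  "design_sum p t P r c M = Matrix.mat r c (\<lambda>ij. \<Sum>s \<in> seqs p t. P s * M s $$ ij)"

definition C_hat ::
  "nat \<Rightarrow> nat \<Rightarrow> nat \<Rightarrow> real Matrix.mat \<Rightarrow> (nat list \<Rightarrow> real) \<Rightarrow> nat \<Rightarrow> nat \<Rightarrow> real Matrix.mat" where
  "C_hat p t n Cov P i j =
     real n \<cdot>\<^sub>m design_sum p t P t t (\<lambda>s. C_hat_seq p t Cov s i j)"

definition G_design :: "nat \<Rightarrow> nat \<Rightarrow> (nat list \<Rightarrow> real) \<Rightarrow> nat \<Rightarrow> real Matrix.mat" where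
  "G_design p t P i = design_sum p t P p t (\<lambda>s. G_seq p t s i * B_mat t)"

definition C_design ::
  "nat \<Rightarrow> nat \<Rightarrow> nat \<Rightarrow> real Matrix.mat \<Rightarrow> (nat list \<Rightarrow> real) \<Rightarrow> nat \<Rightarrow> nat \<Rightarrow> real Matrix.mat" where
  "C_design p t n Cov P i j = C_hat p t n Cov P i j -
     real n \<cdot>\<^sub>m (transpose_mat (G_design p t P i) * B_tilde p Cov * G_design p t P j)"

definition c_seq :: "nat \<Rightarrow> nat \<Rightarrow> real Matrix.mat \<Rightarrow> nat list \<Rightarrow> nat \<Rightarrow> nat \<Rightarrow> real" where
  "c_seq p t Cov s i j = mat_trace (C_hat_seq p t Cov s i j)"

definition c_design ::
  "nat \<Rightarrow> nat \<Rightarrow> nat \<Rightarrow> real Matrix.mat \<Rightarrow> (nat list \<Rightarrow> real) \<Rightarrow> nat \<Rightarrow> nat \<Rightarrow> real" where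
  "c_design p t n Cov P i j = real n * (\<Sum>s \<in> seqs p t. P s * c_seq p t Cov s i j)"

definition q_seq :: "nat \<Rightarrow> nat \<Rightarrow> real Matrix.mat \<Rightarrow> nat list \<Rightarrow> real \<Rightarrow> real" where
  "q_seq p t Cov s x =
     c_seq p t Cov s 1 1 + 2 * c_seq p t Cov s 1 2 * x + c_seq p t Cov s 2 2 * x\<^sup>2"

definition q_design ::
  "nat \<Rightarrow> nat \<Rightarrow> real Matrix.mat \<Rightarrow> (nat list \<Rightarrow> real) \<Rightarrow> real \<Rightarrow> real" where
  "q_design p t Cov P x = (\<Sum>s \<in> seqs p t. P s * q_seq p t Cov s x)"

text \<open>The denominator is positive for every design, since \<open>p, t \<ge> 2\<close> and \<open>n \<ge> 1\<close>.\<close>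

definition x_design ::
  "nat \<Rightarrow> nat \<Rightarrow> nat \<Rightarrow> real Matrix.mat \<Rightarrow> (nat list \<Rightarrow> real) \<Rightarrow> real" where
  "x_design p t n Cov P = - c_design p t n Cov P 1 2 / c_design p t n Cov P 2 2"

definition pseudo_symmetric ::
  "nat \<Rightarrow> nat \<Rightarrow> nat \<Rightarrow> real Matrix.mat \<Rightarrow> (nat list \<Rightarrow> real) \<Rightarrow> bool" where
  "pseudo_symmetric p t n Cov P \<longleftrightarrow>
     (\<forall>k < p. \<forall>i < t. (\<Sum>s \<in> {s \<in> seqs p t. s ! k = i}. P s) = 1 / real t) \<and>
     (\<forall>i \<in> {1, 2}. \<forall>j \<in> {1, 2}. completely_symmetric t (C_design p t n Cov P i j))"

section \<open>Information matrix, prior and optimality\<close>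

definition info_mat ::
  "nat \<Rightarrow> nat \<Rightarrow> nat \<Rightarrow> real Matrix.mat \<Rightarrow> (nat list \<Rightarrow> real) \<Rightarrow> real Matrix.vec \<Rightarrow> real \<Rightarrow> real Matrix.mat"
where
  "info_mat p t n Cov P tau lam = (let
      C11 = C_design p t n Cov P 1 1;
      C12 = C_design p t n Cov P 1 2;
      C21 = C_design p t n Cov P 2 1;
      C22 = C_design p t n Cov P 2 2;
      tau_col = mat_of_cols t [tau];
      quad = scalar_prod tau (C22 *\<^sub>v tau)
    in C11 + lam \<cdot>\<^sub>m (C12 + C21) + lam\<^sup>2 \<cdot>\<^sub>m C22 -
       (if quad = 0 then 0\<^sub>m t t
        else (1 / quad) \<cdot>\<^sub>m
          ((C12 + lam \<cdot>\<^sub>m C22) * tau_col * transpose_mat tau_col * (C21 + lam \<cdot>\<^sub>m C22))))"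

text \<open>
  \<open>\<real>\<^sup>t\<close> as a measurable space: functions on \<open>{..<t}\<close> (extended by \<open>undefined\<close>) with the
  product, i.e. Borel, sigma-algebra.
\<close>

abbreviation Rt :: "nat \<Rightarrow> (nat \<Rightarrow> real) measure" where
  "Rt t \<equiv> PiM {..<t} (\<lambda>_. borel)"

definition is_prior :: "nat \<Rightarrow> (nat \<Rightarrow> real) measure \<Rightarrow> bool" where
  "is_prior t g \<longleftrightarrow> prob_space g \<and> sets g = sets (Rt t) \<and>
     (AE x in g. (\<Sum>i<t. x i) = 0 \<and> (\<exists>i<t. x i \<noteq> 0))"

definition exchangeable :: "nat \<Rightarrow> (nat \<Rightarrow> real) measure \<Rightarrow> bool" where
  "exchangeable t g \<longleftrightarrow>
     (\<forall>\<pi>. \<pi> permutes {..<t} \<longrightarrow> distr g (Rt t) (\<lambda>x. \<lambda>i\<in>{..<t}. x (\<pi> i)) = g)"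

definition T_crit ::
  "nat \<Rightarrow> nat \<Rightarrow> nat \<Rightarrow> real Matrix.mat \<Rightarrow> (nat \<Rightarrow> real) measure \<Rightarrow> real \<Rightarrow> (nat list \<Rightarrow> real) \<Rightarrow> real" where
  "T_crit p t n Cov g lam P =
     (\<integral>x. Phi_T t (info_mat p t n Cov P (Matrix.vec t x) lam) \<partial>g)"

definition T_optimal ::
  "nat \<Rightarrow> nat \<Rightarrow> nat \<Rightarrow> real Matrix.mat \<Rightarrow> (nat \<Rightarrow> real) measure \<Rightarrow> real \<Rightarrow> (nat list \<Rightarrow> real) \<Rightarrow> bool" where
  "T_optimal p t n Cov g lam P \<longleftrightarrow> is_design p t P \<and>
     (\<forall>P'. is_design p t P' \<longrightarrow> T_crit p t n Cov g lam P' \<le> T_crit p t n Cov g lam P)"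

end

theory Submission
  imports Defs "Jordan_Normal_Form.Schur_Decomposition"
begin

text \<open>
  Every information matrix is nonnegative definite with zero row sums, so \<open>Phi_T\<close> is its trace
  divided by \<open>t - 1\<close>. For any real \<open>z\<close>, completing the square in the Schur complement bounds this
  trace by an expression linear in the matrices \<open>C_design\<close> and in \<open>\<tau> \<tau>' / |\<tau>|\<^sup>2\<close>. An exchangeable
  prior has \<open>E (\<tau> \<tau>' / |\<tau>|\<^sup>2) = B_t / (t - 1)\<close>, and dropping the nonnegative correction for the means
  turns the bound into \<open>n \<Sum>\<^sub>s p\<^sub>s (q\<^sub>s(z) + (t - 2) q\<^sub>s(\<lambda>)) / (t - 1)\<^sup>2\<close>, linear in the design. For pseudo
  symmetric designs and \<open>z = x_d\<close> it is an equality. Hence the condition on the sequences is sufficient;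
  it is necessary because \<open>d\<close> can be moved towards the orbit of any sequence under the relabelings of
  the treatments while remaining in the class of designs for which equality holds.
\<close>

section \<open>Eigenvalues of symmetric matrices\<close>

text \<open>The criterion is not linear in the design: the Schur complement divides by
  \<open>tau' C22 tau\<close>, and \<open>C_design\<close> subtracts products of means. The free
  number \<open>z\<close> overcomes this. Fixed at the \<open>x_d\<close> of the candidate for every
  competitor, it gives one linear majorant of the criterion that touches it at the candidate. The
  multiplier in the completed square is \<open>(z - lam) / |tau|^2\<close>. The division by
  \<open>|tau|^2\<close> makes the bound homogeneous of degree 0 in \<open>tau\<close>, so its
  expectation exists without moment conditions and follows from exchangeability. One factor
  \<open>t - 1\<close> comes from \<open>Phi_T\<close>, the other from the expectation. The
  \<open>t - 2\<close> arises because the Schur complement replaces \<open>q(lam)\<close> by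
  \<open>q(z)\<close> in one of the \<open>t - 1\<close> directions orthogonal to the constants. For
  necessity the obstacle is that \<open>x_d\<close> moves with the design; as it minimises
  \<open>q_d\<close>, an inequality in the right direction absorbs the motion. The path has to stay
  where the criterion is known exactly. Since \<open>C_design\<close> is quadratic in the design,
  pseudo symmetry is traded for the conditions of \<open>balanced\<close>, which are linear.\<close>

lemma eigenvalue_of_real_symmetric_real:
  fixes A :: "real Matrix.mat"
  assumes A: "A \<in> carrier_mat n n" and sym: "transpose_mat A = A"
    and ev: "eigenvalue (map_mat complex_of_real A) e"
  shows "e \<in> \<real>"
proof -
  let ?C = "map_mat complex_of_real A"
  obtain v where v: "v \<in> carrier_vec n" "v \<noteq> 0\<^sub>v n" and Cv: "?C *\<^sub>v v = e \<cdot>\<^sub>v v"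
    using ev A unfolding eigenvalue_def eigenvector_def by auto
  have row: "(\<Sum>j<n. of_real (A $$ (i,j)) * v $ j) = e * v $ i" if "i < n" for i
    using arg_cong[OF Cv, of "\<lambda>w. w $ i"] that A v
    by (simp add: scalar_prod_def atLeast0LessThan)
  have symA: "A $$ (i,j) = A $$ (j,i)" if "i < n" "j < n" for i j
    using arg_cong[OF sym, of "\<lambda>M. M $$ (i,j)"] A that by simp
  define N where "N = (\<Sum>i<n. cnj (v $ i) * v $ i)"
  have N: "N = of_real (\<Sum>i<n. (cmod (v $ i))\<^sup>2)"
    unfolding N_def by (simp add: complex_norm_square mult.commute del: of_real_power)
  have "N \<noteq> 0"
  proof
    assume "N = 0"
    hence "(\<Sum>i<n. (cmod (v $ i))\<^sup>2) = 0" unfolding N using of_real_eq_0_iff by blast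
    hence "\<forall>i<n. v $ i = 0" by (simp add: sum_nonneg_eq_0_iff)
    thus False using v by (auto simp: vec_eq_iff)
  qed
  \<comment> \<open>\<open>e * N\<close> is the Hermitian form of \<open>A\<close> at
    \<open>v\<close>; as \<open>A\<close> is real and symmetric, the form equals its own
    conjugate.\<close>
  have "e * N = (\<Sum>i<n. cnj (v $ i) * (\<Sum>j<n. of_real (A $$ (i,j)) * v $ j))"
    unfolding N_def sum_distrib_left[of e] by (intro sum.cong) (simp_all add: row)
  also have "\<dots> = (\<Sum>i<n. \<Sum>j<n. cnj (v $ i) * of_real (A $$ (i,j)) * v $ j)"
    by (simp add: sum_distrib_left mult.assoc)
  finally have eN: "e * N = (\<Sum>i<n. \<Sum>j<n. cnj (v $ i) * of_real (A $$ (i,j)) * v $ j)" .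
  have "cnj (e * N) = (\<Sum>i<n. \<Sum>j<n. cnj (v $ j) * of_real (A $$ (i,j)) * v $ i)"
    unfolding eN by (simp add: mult_ac)
  also have "\<dots> = (\<Sum>j<n. \<Sum>i<n. cnj (v $ j) * of_real (A $$ (i,j)) * v $ i)"
    by (rule sum.swap)
  also have "\<dots> = e * N"
    unfolding eN by (intro sum.cong) (auto simp: symA)
  finally have "cnj (e * N) = e * N" .
  hence "cnj e * N = e * N" unfolding N by simp
  with \<open>N \<noteq> 0\<close> show ?thesis by (simp add: Reals_cnj_iff)
qed

text \<open>The polynomial splits over the complex numbers and all its roots are real, so the
  factorization is the image of a real one; injectivity of the embedding brings it back.\<close>

lemma char_poly_real_symmetric_factorized:
  fixes A :: "real Matrix.mat"
  assumes A: "A \<in> carrier_mat n n" and sym: "transpose_mat A = A"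
  shows "\<exists>es. char_poly A = (\<Prod>e\<leftarrow>es. [:- e, 1:]) \<and> length es = n"
proof -
  interpret of_real_poly_hom: map_poly_inj_idom_hom complex_of_real ..
  let ?C = "map_mat complex_of_real A"
  have C: "?C \<in> carrier_mat n n" using A by simp
  obtain as where as: "char_poly ?C = (\<Prod>a\<leftarrow>as. [:- a, 1:])" "length as = n"
    using char_poly_factorized[OF C] by auto
  have real: "of_real (Re a) = a" if "a \<in> set as" for a
  proof -
    have "poly (char_poly ?C) a = 0" unfolding as(1) using that by (rule linear_poly_root)
    hence "eigenvalue ?C a" using eigenvalue_root_char_poly[OF C] by simp
    thus ?thesis using eigenvalue_of_real_symmetric_real[OF A sym] of_real_Re by blast
  qed
  have "char_poly ?C = map_poly complex_of_real (char_poly A)"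
    by (rule of_real_hom.char_poly_hom[OF A])
  hence "map_poly complex_of_real (char_poly A) = (\<Prod>a\<leftarrow>as. [:- a, 1:])"
    using as(1) by simp
  also have "\<dots> = (\<Prod>a\<leftarrow>as. map_poly complex_of_real [:- Re a, 1:])"
    using real by (intro arg_cong[of _ _ prod_list] map_cong) (auto simp: map_poly_pCons)
  also have "\<dots> = map_poly complex_of_real (\<Prod>e\<leftarrow>map Re as. [:- e, 1:])"
    by (simp add: of_real_poly_hom.hom_prod_list o_def)
  finally have "char_poly A = (\<Prod>e\<leftarrow>map Re as. [:- e, 1:])"
    using of_real_poly_hom.injectivity by blast
  thus ?thesis using as(2) by (intro exI[of _ "map Re as"]) simp
qed

lemma proots_prod_linear:
  "proots (\<Prod>e\<leftarrow>es. [:- e, 1::'a::field:]) = mset es"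
proof (induction es)
  case (Cons a es)
  have "(\<Prod>e\<leftarrow>es. [:- e, 1::'a:]) \<noteq> 0" unfolding prod_list_zero_iff by auto
  with Cons show ?case
    by (simp only: list.map prod_list.Cons) (subst proots_mult, auto)
qed simp

lemma mat_trace_mult_commute:
  assumes A: "A \<in> carrier_mat n m" and B: "B \<in> carrier_mat m n"
  shows "mat_trace (A * B) = mat_trace (B * A)"
proof -
  have "mat_trace (A * B) = (\<Sum>i<n. \<Sum>j<m. A $$ (i,j) * B $$ (j,i))"
    unfolding mat_trace_def using A B by (simp add: scalar_prod_def atLeast0LessThan)
  also have "\<dots> = (\<Sum>j<m. \<Sum>i<n. A $$ (i,j) * B $$ (j,i))" by (rule sum.swap)
  also have "\<dots> = mat_trace (B * A)"
    unfolding mat_trace_def using A B by (simp add: scalar_prod_def atLeast0LessThan mult.commute)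
  finally show ?thesis .
qed

text \<open>A split characteristic polynomial gives a triangular matrix similar to \<open>A\<close>.
  Similarity preserves the trace and the polynomial; the diagonal matches \<open>es\<close> only up
  to order, hence the detour through multisets of roots.\<close>

lemma mat_trace_eq_sum_roots:
  assumes A: "A \<in> carrier_mat n n" and split: "char_poly A = (\<Prod>e\<leftarrow>es. [:- e, 1:])"
  shows "mat_trace A = sum_list es"
proof -
  obtain B where B: "B \<in> carrier_mat n n" "upper_triangular B" "similar_mat A B"
    using schur_decomposition_exists[OF A split] by blast
  obtain S Q where "similar_mat_wit A B S Q" using B(3) unfolding similar_mat_def by blast
  hence w: "S * Q = 1\<^sub>m n" "Q * S = 1\<^sub>m n" "A = S * B * Q" 
    "S \<in> carrier_mat n n" "Q \<in> carrier_mat n n"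
    using A unfolding similar_mat_wit_def Let_def by auto
  have "mat_trace A = mat_trace (Q * (S * B))"
    unfolding w(3) using w(4,5) B(1) by (intro mat_trace_mult_commute) auto
  also have "Q * (S * B) = B"
    using w B(1) by (simp flip: assoc_mult_mat)
  also have "mat_trace B = sum_list (diag_mat B)"
    unfolding mat_trace_def diag_mat_def by (simp add: sum_list_sum_nth atLeast0LessThan)
  finally have tr: "mat_trace A = sum_list (diag_mat B)" .
  have "(\<Prod>e\<leftarrow>es. [:- e, 1:]) = (\<Prod>e\<leftarrow>diag_mat B. [:- e, 1:])"
    using char_poly_similar[OF B(3)] char_poly_upper_triangular[OF B(1,2)] split by simp
  hence "mset es = mset (diag_mat B)" by (metis proots_prod_linear)
  thus ?thesis unfolding tr by (metis sum_mset_sum_list)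
qed

text \<open>Definiteness makes all eigenvalues nonnegative, and the all-ones vector has eigenvalue
  0. The least entry of the sorted list, the one that \<open>Phi_T\<close> leaves out, is therefore
  0, and the remaining entries add up to the trace.\<close>

lemma Phi_T_eq_trace:
  fixes A :: "real Matrix.mat"
  assumes t: "t \<ge> 2" and A: "A \<in> carrier_mat t t"
    and sym: "\<And>i j. i < t \<Longrightarrow> j < t \<Longrightarrow> A $$ (i,j) = A $$ (j,i)"
    and psd: "\<And>u. 0 \<le> (\<Sum>i<t. \<Sum>j<t. u i * A $$ (i,j) * u j)"
    and rows: "\<And>i. i < t \<Longrightarrow> (\<Sum>j<t. A $$ (i,j)) = 0"
  shows "Phi_T t A = (\<Sum>i<t. A $$ (i,i)) / (real t - 1)"
proof -
  have "transpose_mat A = A" using A sym by (intro eq_matI) auto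
  then obtain es where es: "char_poly A = (\<Prod>e\<leftarrow>es. [:- e, 1:])" "length es = t"
    using char_poly_real_symmetric_factorized[OF A] by blast
  define xs where "xs = eigenvalues A"
  have xs: "xs = sort es"
    unfolding xs_def eigenvalues_def es(1) proots_prod_linear by simp
  have ev: "eigenvalue A e \<longleftrightarrow> e \<in> set es" for e
    unfolding eigenvalue_root_char_poly[OF A] es(1) poly_prod_list prod_list_zero_iff by auto
  have nonneg: "e \<ge> 0" if e: "e \<in> set es" for e
  proof -
    obtain v where v: "v \<in> carrier_vec t" "v \<noteq> 0\<^sub>v t" "A *\<^sub>v v = e \<cdot>\<^sub>v v"
      using e[folded ev] A unfolding eigenvalue_def eigenvector_def by auto
    have row: "(\<Sum>j<t. A $$ (i,j) * v $ j) = e * v $ i" if "i < t" for i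
      using arg_cong[OF v(3), of "\<lambda>w. w $ i"] that A v(1)
      by (simp add: scalar_prod_def atLeast0LessThan)
    obtain i where i: "i < t" "v $ i \<noteq> 0" using v(1,2) by (auto simp: vec_eq_iff)
    have "0 \<le> (\<Sum>i<t. v $ i * (\<Sum>j<t. A $$ (i,j) * v $ j))"
      using psd[of "\<lambda>i. v $ i"] by (simp add: sum_distrib_left mult.assoc)
    also have "\<dots> = (\<Sum>i<t. v $ i * (e * v $ i))"
      by (simp add: row)
    also have "\<dots> = e * (\<Sum>i<t. (v $ i)\<^sup>2)"
      by (simp add: sum_distrib_left power2_eq_square mult_ac)
    finally have "0 \<le> e * (\<Sum>i<t. (v $ i)\<^sup>2)" .
    moreover have "0 < (\<Sum>i<t. (v $ i)\<^sup>2)"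
      using i by (intro sum_pos2[of _ i]) auto
    ultimately show ?thesis by (simp add: zero_le_mult_iff)
  qed
  have "eigenvector A (ones_vec t) 0"
  proof -
    have "A *\<^sub>v ones_vec t = 0 \<cdot>\<^sub>v ones_vec t"
      using A rows by (intro eq_vecI) (auto simp: ones_vec_def scalar_prod_def atLeast0LessThan)
    moreover have "ones_vec t \<noteq> 0\<^sub>v t"
    proof
      assume "ones_vec t = 0\<^sub>v t"
      hence "ones_vec t $ 0 = 0\<^sub>v t $ 0" by simp
      thus False using t by (simp add: ones_vec_def)
    qed
    ultimately show ?thesis using A unfolding eigenvector_def by (auto simp: ones_vec_def)
  qed
  hence "0 \<in> set es" using ev unfolding eigenvalue_def by blast
  have len: "length xs = t" using es(2) xs by simp
  have "0 \<in> set xs" using \<open>0 \<in> set es\<close> xs by simp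
  then obtain k where k: "k < t" "xs ! k = 0" using len by (auto simp: in_set_conv_nth)
  have "xs ! 0 \<le> xs ! k" using k(1) len xs by (intro sorted_nth_mono) auto
  moreover have "xs ! 0 \<in> set es" using len t xs by (metis nth_mem set_sort less_le_trans zero_less_numeral)
  ultimately have x0: "xs ! 0 = 0" using nonneg k(2) by force
  have "mat_trace A = sum_list xs"
    unfolding mat_trace_eq_sum_roots[OF A es(1)] xs by (metis mset_sort sum_mset_sum_list)
  also have "\<dots> = (\<Sum>i<t. xs ! i)" by (simp add: sum_list_sum_nth len atLeast0LessThan)
  also have "{..<t} = insert 0 {1..t-1}" using t by auto
  also have "(\<Sum>i\<in>\<dots>. xs ! i) = (\<Sum>i=1..t-1. xs ! i)" using x0 by simp
  finally show ?thesis
    unfolding Phi_T_def xs_def[symmetric] mat_trace_def using A by simp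
qed

section \<open>The bilinear form of B-tilde\<close>

text \<open>The arguments are plain functions rather than vectors, so that the linearity rules carry
  no dimension conditions.\<close>

definition mbil :: "nat \<Rightarrow> real Matrix.mat \<Rightarrow> (nat \<Rightarrow> real) \<Rightarrow> (nat \<Rightarrow> real) \<Rightarrow> real" where
  "mbil p M f g = (\<Sum>k<p. \<Sum>l<p. f k * M $$ (k,l) * g l)"

lemma mbil_cong:
  "(\<And>k. k < p \<Longrightarrow> f k = f' k) \<Longrightarrow> (\<And>k. k < p \<Longrightarrow> g k = g' k) \<Longrightarrow> mbil p M f g = mbil p M f' g'"
  unfolding mbil_def by (intro sum.cong) auto

lemma mbil_commute:
  assumes "\<And>k l. k < p \<Longrightarrow> l < p \<Longrightarrow> M $$ (k,l) = M $$ (l,k)"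
  shows "mbil p M f g = mbil p M g f"
proof -
  have "mbil p M f g = (\<Sum>l<p. \<Sum>k<p. f k * M $$ (k,l) * g l)"
    unfolding mbil_def by (rule sum.swap)
  also have "\<dots> = mbil p M g f"
    unfolding mbil_def by (intro sum.cong) (auto simp: assms)
  finally show ?thesis .
qed

lemma mbil_lin_left:
  "mbil p M (\<lambda>k. a * f k + b * g k) h = a * mbil p M f h + b * mbil p M g h"
  unfolding mbil_def by (simp add: algebra_simps sum.distrib sum_distrib_left)

lemma mbil_lin_right:
  "mbil p M h (\<lambda>k. a * f k + b * g k) = a * mbil p M h f + b * mbil p M h g"
  unfolding mbil_def by (simp add: algebra_simps sum.distrib sum_distrib_left)

lemma mbil_diff_left: "mbil p M (\<lambda>k. f k - g k) h = mbil p M f h - mbil p M g h"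
  using mbil_lin_left[of p M 1 f "-1" g h] by simp

lemma mbil_diff_right: "mbil p M h (\<lambda>k. f k - g k) = mbil p M h f - mbil p M h g"
  using mbil_lin_right[of p M h 1 f "-1" g] by simp

lemma mbil_zero_left: "mbil p M (\<lambda>_. 0) g = 0"
  unfolding mbil_def by simp

lemma mbil_zero_right: "mbil p M g (\<lambda>_. 0) = 0"
  unfolding mbil_def by simp

lemma mbil_sum_left:
  "mbil p M (\<lambda>k. \<Sum>i\<in>I. c i * f i k) g = (\<Sum>i\<in>I. c i * mbil p M (f i) g)"
proof (cases "finite I")
  case True
  thus ?thesis
    by (induction I) (simp_all add: mbil_zero_left mbil_lin_left[where b = 1, simplified])
qed (simp add: mbil_zero_left)

lemma mbil_sum_right:
  "mbil p M g (\<lambda>k. \<Sum>i\<in>I. c i * f i k) = (\<Sum>i\<in>I. c i * mbil p M g (f i))"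
proof (cases "finite I")
  case True
  thus ?thesis
    by (induction I) (simp_all add: mbil_zero_right mbil_lin_right[where b = 1, simplified])
qed (simp add: mbil_zero_right)

lemma mbil_scalar_prod:
  assumes "M \<in> carrier_mat p p"
  shows "scalar_prod (Matrix.vec p f) (M *\<^sub>v Matrix.vec p g) = mbil p M f g"
  using assms by (simp add: mbil_def scalar_prod_def atLeast0LessThan sum_distrib_left mult.assoc)

text \<open>Symmetry follows by evaluating the product of the transpose of \<open>V\<close>,
  \<open>A\<close> and \<open>V\<close> in two ways. For positivity put \<open>w = V v\<close>: the
  form of \<open>V\<close> at \<open>v\<close> is the form of \<open>A\<close> at
  \<open>w\<close>.\<close>

lemma sym_pos_def_mat_inverse:
  assumes pd: "sym_pos_def p A"
  obtains V where "mat_inverse A = Some V" "sym_pos_def p V"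
proof -
  have A: "A \<in> carrier_mat p p" and sym: "transpose_mat A = A"
    and pos: "\<And>v. v \<in> carrier_vec p \<Longrightarrow> v \<noteq> 0\<^sub>v p \<Longrightarrow> scalar_prod v (A *\<^sub>v v) > 0"
    using pd unfolding sym_pos_def_def by auto
  have "det A \<noteq> 0"
  proof
    assume "det A = 0"
    then obtain v where v: "v \<in> carrier_vec p" "v \<noteq> 0\<^sub>v p" "A *\<^sub>v v = 0\<^sub>v p"
      using det_0_iff_vec_prod_zero[OF A] by blast
    thus False using pos[OF v(1,2)] by simp
  qed
  hence "A \<in> Units (ring_mat TYPE(real) p ())" by (rule det_non_zero_imp_unit[OF A])
  then obtain V where V: "mat_inverse A = Some V" 
    using mat_inverse(1)[OF A] by fastforce
  hence inv: "A * V = 1\<^sub>m p" "V * A = 1\<^sub>m p" "V \<in> carrier_mat p p"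
    using mat_inverse(2)[OF A V] by auto
  have "transpose_mat V * A = transpose_mat (A * V)"
    using A inv(3) sym by (simp add: transpose_mult)
  hence "transpose_mat V * A = 1\<^sub>m p" using inv(1) by simp
  hence "transpose_mat V * (A * V) = V"
    using A inv(3) by (simp flip: assoc_mult_mat)
  hence symV: "transpose_mat V = V" using inv(1,3) by simp
  have "scalar_prod v (V *\<^sub>v v) > 0" if v: "v \<in> carrier_vec p" "v \<noteq> 0\<^sub>v p" for v
  proof -
    define w where "w = V *\<^sub>v v"
    have w: "w \<in> carrier_vec p" unfolding w_def using inv(3) v by simp
    have Aw: "A *\<^sub>v w = v"
      unfolding w_def using A inv v by (simp flip: assoc_mult_mat_vec)
    hence "w \<noteq> 0\<^sub>v p" using v(2) A by auto
    hence "scalar_prod w (A *\<^sub>v w) > 0" using pos w by blast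
    thus ?thesis unfolding Aw using w v(1) by (simp add: w_def[symmetric] comm_scalar_prod[OF w])
  qed
  thus thesis using that[OF V] inv(3) symV unfolding sym_pos_def_def by blast
qed

text \<open>The form of \<open>B_tilde\<close> is that of \<open>V\<close>, the inverse of
  \<open>Cov\<close>, after the \<open>V\<close>-weighted mean over the periods has been subtracted.
  Hence it is nonnegative and vanishes only on functions that are constant over the periods.\<close>

lemma
  assumes pd: "sym_pos_def p Cov" and p: "p \<ge> 1"
  shows B_tilde_carrier: "B_tilde p Cov \<in> carrier_mat p p"
    and B_tilde_sym: "\<And>k l. k < p \<Longrightarrow> l < p \<Longrightarrow> B_tilde p Cov $$ (k,l) = B_tilde p Cov $$ (l,k)"
    and B_tilde_nonneg: "\<And>f. 0 \<le> mbil p (B_tilde p Cov) f f"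
    and B_tilde_zero: "\<And>f. mbil p (B_tilde p Cov) f f = 0 \<Longrightarrow> \<exists>c. \<forall>k<p. f k = c"
proof -
  obtain V where V: "mat_inverse Cov = Some V" and pdV: "sym_pos_def p V"
    using sym_pos_def_mat_inverse[OF pd] .
  have Vc: "V \<in> carrier_mat p p" and tV: "transpose_mat V = V"
    and pos: "\<And>v. v \<in> carrier_vec p \<Longrightarrow> v \<noteq> 0\<^sub>v p \<Longrightarrow> scalar_prod v (V *\<^sub>v v) > 0"
    using pdV unfolding sym_pos_def_def by auto
  have symV: "V $$ (k,l) = V $$ (l,k)" if "k < p" "l < p" for k l
    using arg_cong[OF tV, of "\<lambda>M. M $$ (k,l)"] Vc that by simp
  have posf: "mbil p V f f > 0" if "k < p" "f k \<noteq> 0" for f k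
    unfolding mbil_scalar_prod[OF Vc, symmetric] using that
    by (intro pos) (auto simp: vec_eq_iff)
  have nonneg: "mbil p V f f \<ge> 0" for f
  proof (cases "\<exists>k<p. f k \<noteq> 0")
    case False
    hence "mbil p V f f = mbil p V (\<lambda>_. 0) (\<lambda>_. 0)" by (intro mbil_cong) auto
    thus ?thesis by (simp add: mbil_zero_left)
  qed (use posf less_imp_le in blast)
  define S where "S = mbil p V (\<lambda>_. 1) (\<lambda>_. 1)"
  have S: "S > 0" unfolding S_def using p by (intro posf[of 0]) auto
  have B: "B_tilde p Cov = V - (1 / S) \<cdot>\<^sub>m (V * J_mat p * V)"
    unfolding B_tilde_def V Let_def option.sel ones_vec_def mbil_scalar_prod[OF Vc] S_def ..
  have J: "J_mat p \<in> carrier_mat p p" unfolding J_mat_def by simp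
  show carrier: "B_tilde p Cov \<in> carrier_mat p p"
    unfolding B using Vc J by auto
  have VJ: "(V * J_mat p) $$ (k,j) = (\<Sum>i<p. V $$ (k,i))" if "k < p" "j < p" for k j
    using that Vc by (simp add: J_mat_def scalar_prod_def atLeast0LessThan)
  have entry: "B_tilde p Cov $$ (k,l) = V $$ (k,l) - (\<Sum>i<p. V $$ (k,i)) * (\<Sum>j<p. V $$ (j,l)) / S"
    if "k < p" "l < p" for k l
  proof -
    have "(V * J_mat p * V) $$ (k,l) = (\<Sum>j<p. (V * J_mat p) $$ (k,j) * V $$ (j,l))"
      using that Vc J by (simp add: scalar_prod_def atLeast0LessThan del: assoc_mult_mat)
    also have "\<dots> = (\<Sum>j<p. (\<Sum>i<p. V $$ (k,i)) * V $$ (j,l))"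
      using that VJ by simp
    finally show ?thesis
      unfolding B using that Vc J by (simp add: sum_divide_distrib sum_distrib_left)
  qed
  show sym: "B_tilde p Cov $$ (k,l) = B_tilde p Cov $$ (l,k)" if "k < p" "l < p" for k l
  proof -
    have "(\<Sum>j<p. V $$ (j,i)) = (\<Sum>j<p. V $$ (i,j))" if "i < p" for i
      using that by (intro sum.cong) (auto simp: symV)
    thus ?thesis unfolding entry[OF that] entry[OF that(2,1)] using that symV by simp
  qed
  have quad: "mbil p (B_tilde p Cov) f f = mbil p V (\<lambda>k. f k - mbil p V f (\<lambda>_. 1) / S) (\<lambda>k. f k - mbil p V f (\<lambda>_. 1) / S)" for f
  proof -
    define m where "m = mbil p V f (\<lambda>_. 1)"
    have m1: "mbil p V (\<lambda>_. 1) f = m" unfolding m_def using symV by (rule mbil_commute)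
    have "mbil p (B_tilde p Cov) f f = (\<Sum>k<p. \<Sum>l<p. f k * V $$ (k,l) * f l
        - (f k * (\<Sum>i<p. V $$ (k,i))) * ((\<Sum>j<p. V $$ (j,l)) * f l) / S)"
      unfolding mbil_def by (intro sum.cong) (auto simp: entry algebra_simps)
    also have "\<dots> = mbil p V f f - (\<Sum>k<p. f k * (\<Sum>i<p. V $$ (k,i))) * (\<Sum>l<p. (\<Sum>j<p. V $$ (j,l)) * f l) / S"
      unfolding mbil_def sum_product sum_divide_distrib by (simp add: sum_subtractf)
    also have "(\<Sum>k<p. f k * (\<Sum>i<p. V $$ (k,i))) = m"
      unfolding m_def mbil_def by (simp add: sum_distrib_left)
    also have "(\<Sum>l<p. (\<Sum>j<p. V $$ (j,l)) * f l) = m"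
      unfolding m1[symmetric] mbil_def sum_distrib_right
      by (subst sum.swap) simp
    finally have L: "mbil p (B_tilde p Cov) f f = mbil p V f f - m * m / S" .
    have "mbil p V (\<lambda>k. f k - m / S) (\<lambda>k. f k - m / S) =
      mbil p V (\<lambda>k. 1 * f k + (- m / S) * 1) (\<lambda>k. 1 * f k + (- m / S) * 1)" by simp
    also have "\<dots> = mbil p V f f - m / S * m - m / S * m + m / S * m / S * S"
      unfolding mbil_lin_left mbil_lin_right m1 m_def[symmetric] S_def[symmetric]
      by (simp add: algebra_simps)
    also have "\<dots> = mbil p V f f - m * m / S" using S by (simp add: field_simps)
    finally show ?thesis using L unfolding m_def by simp
  qed
  show "0 \<le> mbil p (B_tilde p Cov) f f" for f
    unfolding quad by (rule nonneg)
  show "\<exists>c. \<forall>k<p. f k = c" if "mbil p (B_tilde p Cov) f f = 0" for f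
    using posf[of _ "\<lambda>k. f k - mbil p V f (\<lambda>_. 1) / S"] that unfolding quad
    by (metis eq_iff_diff_eq_0 less_irrefl)
qed

section \<open>Entries of the design matrices\<close>

text \<open>Entry \<open>(k, a)\<close> of \<open>G_seq\<close> times \<open>B_mat\<close>. The
  centring acts on treatments, from the right, so the zero first row of the carryover matrix stays
  zero and receives no \<open>- 1 / t\<close>. As in \<open>G_seq\<close>, every index other than 1
  stands for carryover.\<close>

definition effect :: "nat \<Rightarrow> nat \<Rightarrow> nat list \<Rightarrow> nat \<Rightarrow> nat \<Rightarrow> real" where
  "effect t i s a k = 
     (if i = 1 then of_bool (s ! k = a) - 1 / real t
      else if k = 0 then 0 else of_bool (s ! (k - 1) = a) - 1 / real t)"

lemma finite_seqs [simp]: "finite (seqs p t)"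
  unfolding seqs_def using finite_lists_length_eq[of "{..<t}" p] by (simp add: conj_commute)

lemma seqs_nth_less: "s \<in> seqs p t \<Longrightarrow> k < p \<Longrightarrow> s ! k < t"
  unfolding seqs_def by (auto dest: nth_mem)

lemma sum_of_bool_eq:
  assumes "b < (t::nat)"
  shows "(\<Sum>a<t. of_bool (b = a) * f a) = (f b :: real)"
    and "(\<Sum>a<t. of_bool (a = b) * f a) = (f b :: real)"
    and "(\<Sum>a<t. f a * of_bool (b = a)) = (f b :: real)"
    and "(\<Sum>a<t. f a * of_bool (a = b)) = (f b :: real)"
    and "(\<Sum>a<t. of_bool (b = a)) = (1 :: real)"
    and "(\<Sum>a<t. of_bool (a = b)) = (1 :: real)"
  using assms by (simp_all add: of_bool_def if_distrib[of "\<lambda>x. x * _"] if_distrib[of "\<lambda>x. _ * x"] cong: if_cong)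

lemma B_mat_carrier [simp]: "B_mat t \<in> carrier_mat t t"
  unfolding B_mat_def J_mat_def by auto

lemma B_mat_entry: "a < t \<Longrightarrow> b < t \<Longrightarrow> B_mat t $$ (a,b) = of_bool (a = b) - 1 / real t"
  unfolding B_mat_def J_mat_def by simp

lemma transpose_B_mat: "transpose_mat (B_mat t) = B_mat t"
  by (rule eq_matI) (auto simp: B_mat_def J_mat_def)

lemma G_seq_carrier [simp]: "G_seq p t s i \<in> carrier_mat p t"
  unfolding G_seq_def T_mat_def F_mat_def by simp

lemma G_seq_mult_B_mat:
  assumes s: "s \<in> seqs p t" and k: "k < p" and a: "a < t"
  shows "(G_seq p t s i * B_mat t) $$ (k,a) = effect t i s a k"
proof -
  have "(G_seq p t s i * B_mat t) $$ (k,a) = (\<Sum>b<t. G_seq p t s i $$ (k,b) * B_mat t $$ (b,a))"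
    using k a G_seq_carrier[of p t s i] B_mat_carrier[of t]
    by (simp add: scalar_prod_def atLeast0LessThan del: G_seq_carrier B_mat_carrier)
  also have "\<dots> = (\<Sum>b<t. G_seq p t s i $$ (k,b) * (of_bool (b = a) - 1 / real t))"
    using a by (intro sum.cong) (auto simp: B_mat_entry)
  also have "\<dots> = effect t i s a k"
  proof (cases "i = 1")
    case True
    have "(\<Sum>b<t. G_seq p t s i $$ (k,b) * (of_bool (b = a) - 1 / real t)) =
        (\<Sum>b<t. of_bool (s ! k = b) * (of_bool (b = a) - 1 / real t))"
      using True k by (intro sum.cong) (auto simp: G_seq_def T_mat_def)
    thus ?thesis using True by (simp add: sum_of_bool_eq seqs_nth_less[OF s k] effect_def)
  next
    case False
    show ?thesis
    proof (cases "k = 0")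
      case True
      thus ?thesis using False k by (simp add: G_seq_def F_mat_def effect_def)
    next
      case k0: False
      have "(\<Sum>b<t. G_seq p t s i $$ (k,b) * (of_bool (b = a) - 1 / real t)) =
          (\<Sum>b<t. of_bool (s ! (k - 1) = b) * (of_bool (b = a) - 1 / real t))"
        using False k k0 by (intro sum.cong) (auto simp: G_seq_def F_mat_def)
      moreover have "s ! (k - 1) < t" using k by (intro seqs_nth_less[OF s]) simp
      ultimately show ?thesis using False k0
        by (simp add: sum_of_bool_eq effect_def)
    qed
  qed
  finally show ?thesis .
qed

lemma sum_effect:
  assumes s: "s \<in> seqs p t" and k: "k < p"
  shows "(\<Sum>a<t. effect t i s a k) = 0"
proof -
  have "s ! k < t" "s ! (k - 1) < t" using k by (auto intro!: seqs_nth_less[OF s])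
  thus ?thesis using k
    by (cases "i = 1"; cases "k = 0")
      (simp_all add: effect_def sum_subtractf sum_of_bool_eq del: One_nat_def)
qed

lemma transpose_mult_mult_entry:
  assumes "M \<in> carrier_mat p t" "K \<in> carrier_mat p t" "N \<in> carrier_mat p p" "a < t" "b < t"
  shows "(transpose_mat M * N * K) $$ (a,b) = mbil p N (\<lambda>k. M $$ (k,a)) (\<lambda>l. K $$ (l,b))"
  using assms by (simp add: mbil_def scalar_prod_def atLeast0LessThan sum_distrib_left mult.assoc)

section \<open>Centred effects and the parabola of a single sequence\<close>

locale crossover =
  fixes p t n :: nat and Cov :: "real Matrix.mat"
  assumes p: "p \<ge> 2" and t: "t \<ge> 2" and n: "n \<ge> 1" and pd: "sym_pos_def p Cov"
begin

abbreviation "bil \<equiv> mbil p (B_tilde p Cov)"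
abbreviation "eff \<equiv> effect t"

lemma bil_nonneg: "0 \<le> bil f f"
  using B_tilde_nonneg[OF pd] p by simp

lemma bil_eq_0: "bil f f = 0 \<Longrightarrow> k < p \<Longrightarrow> l < p \<Longrightarrow> f k = f l"
  using B_tilde_zero[OF pd] p by (metis One_nat_def Suc_leD numeral_2_eq_2)

lemma bil_commute: "bil f g = bil g f"
  using B_tilde_sym[OF pd] p by (intro mbil_commute) auto

lemma B_tilde_in_carrier [simp]: "B_tilde p Cov \<in> carrier_mat p p"
  using B_tilde_carrier[OF pd] p by simp

lemma C_hat_seq_carrier [simp]: "C_hat_seq p t Cov s i j \<in> carrier_mat t t"
  unfolding C_hat_seq_def
  by (intro mult_carrier_mat[of _ t t] mult_carrier_mat[of _ t p] transpose_carrier_mat) auto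

lemma C_hat_seq_entry:
  assumes s: "s \<in> seqs p t" and a: "a < t" and b: "b < t"
  shows "C_hat_seq p t Cov s i j $$ (a,b) = bil (eff i s a) (eff j s b)"
proof -
  have G: "G_seq p t s i \<in> carrier_mat p t" for i by simp
  have B: "B_mat t \<in> carrier_mat t t" by simp
  have "transpose_mat (G_seq p t s i * B_mat t) = B_mat t * transpose_mat (G_seq p t s i)"
    using transpose_mult[OF G B] transpose_B_mat by simp
  hence "C_hat_seq p t Cov s i j = 
      transpose_mat (G_seq p t s i * B_mat t) * B_tilde p Cov * G_seq p t s j * B_mat t"
    unfolding C_hat_seq_def by simp
  also have "\<dots> = transpose_mat (G_seq p t s i * B_mat t) * B_tilde p Cov * (G_seq p t s j * B_mat t)"
    by (rule assoc_mult_mat[of _ t p, OF _ G B])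
      (rule mult_carrier_mat[OF _ B_tilde_in_carrier], use mult_carrier_mat[OF G B] in simp)
  finally have "C_hat_seq p t Cov s i j = \<dots>" .
  hence "C_hat_seq p t Cov s i j $$ (a,b) = 
     bil (\<lambda>k. (G_seq p t s i * B_mat t) $$ (k,a)) (\<lambda>l. (G_seq p t s j * B_mat t) $$ (l,b))"
    using transpose_mult_mult_entry[OF mult_carrier_mat[OF G B] mult_carrier_mat[OF G B] B_tilde_in_carrier a b]
    by simp
  also have "\<dots> = bil (eff i s a) (eff j s b)"
    by (intro mbil_cong G_seq_mult_B_mat s a b)
  finally show ?thesis .
qed

lemma c_seq_eq:
  assumes "s \<in> seqs p t"
  shows "c_seq p t Cov s i j = (\<Sum>a<t. bil (eff i s a) (eff j s a))"
  unfolding c_seq_def mat_trace_def using carrier_matD(1)[OF C_hat_seq_carrier] assms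
  by (simp add: C_hat_seq_entry)

text \<open>This exhibits \<open>q_seq\<close> as a sum of squared \<open>B_tilde\<close> lengths of
  direct effects plus \<open>x\<close> times carryover effects. Positivity thereby reduces to
  finding one treatment whose combined profile is not constant over the periods.\<close>

lemma q_seq_eq:
  assumes "s \<in> seqs p t"
  shows "q_seq p t Cov s x = 
    (\<Sum>a<t. bil (\<lambda>k. eff 1 s a k + x * eff 2 s a k) (\<lambda>k. eff 1 s a k + x * eff 2 s a k))"
proof -
  have "bil (\<lambda>k. eff 1 s a k + x * eff 2 s a k) (\<lambda>k. eff 1 s a k + x * eff 2 s a k) =
     bil (eff 1 s a) (eff 1 s a) + 2 * bil (eff 1 s a) (eff 2 s a) * x + bil (eff 2 s a) (eff 2 s a) * x\<^sup>2" for a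
    unfolding mbil_lin_left[where a = 1, simplified] mbil_lin_right[where a = 1, simplified]
    by (simp add: bil_commute[of "eff 2 s a" "eff 1 s a"] algebra_simps power2_eq_square del: One_nat_def)
  thus ?thesis
    unfolding q_seq_def by (simp add: c_seq_eq assms sum.distrib sum_distrib_left sum_distrib_right)
qed

lemma q_seq_nonneg: "s \<in> seqs p t \<Longrightarrow> 0 \<le> q_seq p t Cov s x"
  by (simp add: q_seq_eq sum_nonneg bil_nonneg)

lemma q_seq_pos:
  assumes "s \<in> seqs p t" "a < t" "k < p" "l < p"
    and "eff 1 s a k + x * eff 2 s a k \<noteq> eff 1 s a l + x * eff 2 s a l"
  shows "0 < q_seq p t Cov s x"
proof -
  let ?f = "\<lambda>a k. eff 1 s a k + x * eff 2 s a k"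
  have "bil (?f a) (?f a) \<noteq> 0"
    using bil_eq_0[of "?f a" k l] assms by blast
  hence "0 < bil (?f a) (?f a)" using bil_nonneg[of "?f a"] by linarith
  thus ?thesis unfolding q_seq_eq[OF assms(1)]
    using assms(2) by (intro sum_pos2[of _ a]) (auto simp: bil_nonneg)
qed

text \<open>No carryover enters at \<open>x = 0\<close>, so the direct effect has to vary: treatment
  0 is given only in the first period. For other \<open>x\<close> the constant sequence works: its
  direct effects are constant, while the carryover effect jumps from 0 to \<open>1 - 1 / t\<close>
  after the first period.\<close>

lemma ex_q_seq_pos: "\<exists>s\<in>seqs p t. 0 < q_seq p t Cov s x"
proof (cases "x = 0")
  case True
  let ?s = "0 # replicate (p - 1) 1"
  have "?s \<in> seqs p t" using p t by (auto simp: seqs_def)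
  moreover have "0 < q_seq p t Cov ?s x"
    using True p t by (intro q_seq_pos[OF calculation, of 0 0 1]) (auto simp: effect_def field_simps)
  ultimately show ?thesis by blast
next
  case False
  let ?s = "replicate p 0"
  have "?s \<in> seqs p t" using p t by (auto simp: seqs_def)
  moreover have "0 < q_seq p t Cov ?s x"
    using False p t by (intro q_seq_pos[OF calculation, of 0 0 1]) (auto simp: effect_def field_simps)
  ultimately show ?thesis by blast
qed

text \<open>The carryover profile is 0 in the first period and either \<open>1 - 1 / t\<close> or
  \<open>- 1 / t\<close> in the second, never 0 as \<open>t\<close> is at least 2; so it is not
  constant.\<close>

lemma c_seq_22_pos:
  assumes s: "s \<in> seqs p t"
  shows "0 < c_seq p t Cov s 2 2"
proof -
  have "bil (eff 2 s 0) (eff 2 s 0) \<noteq> 0"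
  proof
    assume "bil (eff 2 s 0) (eff 2 s 0) = 0"
    hence "eff 2 s 0 0 = eff 2 s 0 1" using p by (intro bil_eq_0) auto
    thus False using t by (auto simp: effect_def of_bool_def field_simps split: if_splits)
  qed
  hence "0 < bil (eff 2 s 0) (eff 2 s 0)" using bil_nonneg[of "eff 2 s 0"] by linarith
  thus ?thesis unfolding c_seq_eq[OF s]
    using t by (intro sum_pos2[of _ 0]) (auto simp: bil_nonneg)
qed

section \<open>The matrices \<open>C_design\<close> as covariances of effects over the
  design\<close>

definition "mean P i a k = (\<Sum>s\<in>seqs p t. P s * eff i s a k)"

lemma G_design_entry:
  "k < p \<Longrightarrow> a < t \<Longrightarrow> G_design p t P i $$ (k,a) = mean P i a k"
  unfolding G_design_def design_sum_def mean_def by (simp add: G_seq_mult_B_mat cong: sum.cong del: index_mult_mat)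

lemma G_design_carrier [simp]: "G_design p t P i \<in> carrier_mat p t"
  unfolding G_design_def design_sum_def by simp

lemma C_design_carrier [simp]: "C_design p t n Cov P i j \<in> carrier_mat t t"
  unfolding C_design_def C_hat_def design_sum_def
  by (intro minus_carrier_mat smult_carrier_mat mult_carrier_mat[of _ t p] transpose_carrier_mat) auto

lemma C_design_entry:
  assumes a: "a < t" and b: "b < t"
  shows "C_design p t n Cov P i j $$ (a,b) = 
    real n * ((\<Sum>s\<in>seqs p t. P s * bil (eff i s a) (eff j s b)) - bil (mean P i a) (mean P j b))"
proof -
  have "(transpose_mat (G_design p t P i) * B_tilde p Cov * G_design p t P j) $$ (a,b) = bil (mean P i a) (mean P j b)"
    unfolding transpose_mult_mult_entry[OF G_design_carrier G_design_carrier B_tilde_in_carrier a b]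
    using a b by (intro mbil_cong G_design_entry)
  moreover have "transpose_mat (G_design p t P i) * B_tilde p Cov * G_design p t P j \<in> carrier_mat t t"
    by (intro mult_carrier_mat[of _ t p] transpose_carrier_mat) auto
  ultimately show ?thesis
    using a b unfolding C_design_def C_hat_def design_sum_def
    by (auto simp: C_hat_seq_entry right_diff_distrib cong: sum.cong simp del: index_mult_mat)
qed

text \<open>The usual covariance identity: as the masses add up to 1, subtracting the product of the
  means amounts to centring both factors. This form makes definiteness visible.\<close>

lemma C_design_entry_centred:
  assumes P: "is_design p t P" and a: "a < t" and b: "b < t"
  shows "C_design p t n Cov P i j $$ (a,b) = real n * 
    (\<Sum>s\<in>seqs p t. P s * bil (\<lambda>k. eff i s a k - mean P i a k) (\<lambda>k. eff j s b k - mean P j b k))"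
proof -
  let ?m = "mean P i a" and ?m' = "mean P j b"
  have 1: "(\<Sum>s\<in>seqs p t. P s) = 1" using P unfolding is_design_def by simp
  have 2: "(\<Sum>s\<in>seqs p t. P s * bil (eff i s a) ?m') = bil ?m ?m'"
    unfolding mean_def[of P i a] mbil_sum_left ..
  have 3: "(\<Sum>s\<in>seqs p t. P s * bil ?m (eff j s b)) = bil ?m ?m'"
    unfolding mean_def[of P j b] mbil_sum_right ..
  have "(\<Sum>s\<in>seqs p t. P s * bil (\<lambda>k. eff i s a k - ?m k) (\<lambda>k. eff j s b k - ?m' k)) =
    (\<Sum>s\<in>seqs p t. P s * bil (eff i s a) (eff j s b)) - (\<Sum>s\<in>seqs p t. P s * bil (eff i s a) ?m')
    - (\<Sum>s\<in>seqs p t. P s * bil ?m (eff j s b)) + (\<Sum>s\<in>seqs p t. P s) * bil ?m ?m'"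
    unfolding mbil_diff_left mbil_diff_right
    by (simp add: algebra_simps sum_subtractf sum.distrib sum_distrib_left sum_distrib_right)
  thus ?thesis unfolding C_design_entry[OF a b] 1 2 3 by simp
qed

lemma C_design_swap:
  "a < t \<Longrightarrow> b < t \<Longrightarrow> C_design p t n Cov P i j $$ (a,b) = C_design p t n Cov P j i $$ (b,a)"
  by (simp add: C_design_entry bil_commute)

text \<open>Centred effects sum to zero over the treatments in each period; by linearity so do the
  means.\<close>

lemma C_design_row_sum:
  assumes a: "a < t"
  shows "(\<Sum>b<t. C_design p t n Cov P i j $$ (a,b)) = 0"
proof -
  have eff0: "(\<Sum>b<t. bil f (eff j s b)) = 0" if "s \<in> seqs p t" for s f
  proof -
    have "(\<Sum>b<t. bil f (eff j s b)) = bil f (\<lambda>k. \<Sum>b<t. eff j s b k)"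
      using mbil_sum_right[of p "B_tilde p Cov" f "\<lambda>_. 1" "\<lambda>b. eff j s b" "{..<t}"] by simp
    also have "\<dots> = bil f (\<lambda>_. 0)"
      using sum_effect[OF that] by (intro mbil_cong) auto
    finally show ?thesis by (simp add: mbil_zero_right)
  qed
  have "(\<Sum>b<t. \<Sum>s\<in>seqs p t. P s * bil (eff i s a) (eff j s b)) =
      (\<Sum>s\<in>seqs p t. P s * (\<Sum>b<t. bil (eff i s a) (eff j s b)))"
    unfolding sum_distrib_left by (rule sum.swap)
  also have "\<dots> = 0" by (simp add: eff0)
  finally have 1: "(\<Sum>b<t. \<Sum>s\<in>seqs p t. P s * bil (eff i s a) (eff j s b)) = 0" .
  have "(\<Sum>b<t. bil f (mean P j b)) = (\<Sum>s\<in>seqs p t. P s * (\<Sum>b<t. bil f (eff j s b)))" for f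
    unfolding mean_def mbil_sum_right sum_distrib_left by (rule sum.swap)
  hence 2: "(\<Sum>b<t. bil f (mean P j b)) = 0" for f by (simp add: eff0)
  show ?thesis using a 1 2
    by (simp add: C_design_entry sum_subtractf flip: sum_distrib_left)
qed

text \<open>This is the form of the joint information matrix of direct and carryover effects at
  \<open>(u, v)\<close>. It is a mean, over the sequences, of the \<open>B_tilde\<close> lengths of
  combined deviations.\<close>

lemma C_design_psd:
  assumes P: "is_design p t P"
  shows "0 \<le> mbil t (C_design p t n Cov P 1 1) u u + 2 * mbil t (C_design p t n Cov P 1 2) u v
    + mbil t (C_design p t n Cov P 2 2) v v"
proof -
  define d where "d i s a k = eff i s a k - mean P i a k" for i s a k
  define w where "w i u s k = (\<Sum>a<t. u a * d i s a k)" for i and u :: "nat \<Rightarrow> real" and s k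
  have form: "mbil t (C_design p t n Cov P i j) u v = real n * (\<Sum>s\<in>seqs p t. P s * bil (w i u s) (w j v s))"
    for i j u v
  proof -
    have "mbil t (C_design p t n Cov P i j) u v = 
      (\<Sum>a<t. \<Sum>b<t. \<Sum>s\<in>seqs p t. real n * (P s * (u a * (v b * bil (d i s a) (d j s b)))))"
      unfolding mbil_def[of t] d_def
      by (intro sum.cong) (auto simp: C_design_entry_centred[OF P] sum_distrib_left sum_distrib_right mult_ac)
    also have "\<dots> = (\<Sum>a<t. \<Sum>s\<in>seqs p t. \<Sum>b<t. real n * (P s * (u a * (v b * bil (d i s a) (d j s b)))))"
      by (intro sum.cong refl sum.swap)
    also have "\<dots> = (\<Sum>s\<in>seqs p t. \<Sum>a<t. \<Sum>b<t. real n * (P s * (u a * (v b * bil (d i s a) (d j s b)))))"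
      by (rule sum.swap)
    also have "\<dots> = real n * (\<Sum>s\<in>seqs p t. P s * bil (w i u s) (w j v s))"
      unfolding w_def mbil_sum_left mbil_sum_right by (simp add: sum_distrib_left)
    finally show ?thesis .
  qed
  have sq: "bil (\<lambda>k. w 1 u s k + w 2 v s k) (\<lambda>k. w 1 u s k + w 2 v s k) =
    bil (w 1 u s) (w 1 u s) + 2 * bil (w 1 u s) (w 2 v s) + bil (w 2 v s) (w 2 v s)" for s
    unfolding mbil_lin_left[where a = 1 and b = 1, simplified] mbil_lin_right[where a = 1 and b = 1, simplified]
    by (simp add: bil_commute[of "w 2 v s" "w 1 u s"] del: One_nat_def)
  have "0 \<le> real n * (\<Sum>s\<in>seqs p t. P s * bil (\<lambda>k. w 1 u s k + w 2 v s k) (\<lambda>k. w 1 u s k + w 2 v s k))"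
    using P by (intro mult_nonneg_nonneg sum_nonneg bil_nonneg) (auto simp: is_design_def)
  thus ?thesis unfolding sq form by (simp add: algebra_simps sum.distrib sum_distrib_left)
qed

end

section \<open>The trace of the information matrix\<close>

declare One_nat_def [simp del]

lemma mat_mult_entry:
  assumes "A \<in> carrier_mat m k" "B \<in> carrier_mat k l" "i < m" "j < l"
  shows "(A * B) $$ (i,j) = (\<Sum>x<k. A $$ (i,x) * B $$ (x,j))"
  using assms by (simp add: scalar_prod_def atLeast0LessThan)

lemma rank_one_sandwich_entry:
  fixes f :: "nat \<Rightarrow> real"
  assumes M: "M \<in> carrier_mat t t" and N: "N \<in> carrier_mat t t" and a: "a < t" and b: "b < t"
  defines "c \<equiv> mat_of_cols t [Matrix.vec t f]"
  shows "(M * c * transpose_mat c * N) $$ (a,b) = 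
    (\<Sum>j<t. M $$ (a,j) * f j) * (\<Sum>j<t. f j * N $$ (j,b))"
proof -
  have c: "c \<in> carrier_mat t 1" and c': "transpose_mat c \<in> carrier_mat 1 t" 
    unfolding c_def by auto
  have Mc: "M * c \<in> carrier_mat t 1" using M c by auto
  have Mcc: "M * c * transpose_mat c \<in> carrier_mat t t" using Mc c' by (rule mult_carrier_mat)
  have c_entry: "c $$ (j,0) = f j" if "j < t" for j
    using that by (simp add: c_def mat_of_cols_def)
  have e1: "(M * c) $$ (i,0) = (\<Sum>j<t. M $$ (i,j) * f j)" if "i < t" for i
    using mat_mult_entry[OF M c that, of 0] by (simp add: c_entry)
  have e2: "(M * c * transpose_mat c) $$ (i,j) = (M * c) $$ (i,0) * f j" if "i < t" "j < t" for i j
    using mat_mult_entry[OF Mc c' that] c that by (simp add: c_entry One_nat_def)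
  have "(M * c * transpose_mat c * N) $$ (a,b) = (\<Sum>j<t. (M * c * transpose_mat c) $$ (a,j) * N $$ (j,b))"
    by (rule mat_mult_entry[OF Mcc N a b])
  also have "\<dots> = (\<Sum>j<t. (\<Sum>j<t. M $$ (a,j) * f j) * (f j * N $$ (j,b)))"
    using a by (intro sum.cong) (auto simp: e2 e1)
  finally show ?thesis by (simp add: sum_distrib_left)
qed

lemma rank_one_sandwich_carrier:
  assumes M: "M \<in> carrier_mat t t" and N: "N \<in> carrier_mat t t"
  shows "M * mat_of_cols t [v] * transpose_mat (mat_of_cols t [v]) * N \<in> carrier_mat t t"
proof -
  have c: "mat_of_cols t [v] \<in> carrier_mat t 1" by auto
  have "transpose_mat (mat_of_cols t [v]) \<in> carrier_mat 1 t" using c by simp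
  from mult_carrier_mat[OF mult_carrier_mat[OF mult_carrier_mat[OF M c] this] N]
  show ?thesis .
qed

lemma mbil_unit_left:
  assumes "a < t"
  shows "mbil t M (\<lambda>i. of_bool (i = a)) g = (\<Sum>j<t. M $$ (a,j) * g j)"
proof -
  have "mbil t M (\<lambda>i. of_bool (i = a)) g = (\<Sum>i<t. of_bool (i = a) * (\<Sum>j<t. M $$ (i,j) * g j))"
    unfolding mbil_def by (simp add: sum_distrib_left mult.assoc)
  thus ?thesis by (simp only: sum_of_bool_eq(2)[OF assms])
qed

lemma affine_nonneg_imp_slope_0:
  fixes A y :: real
  assumes "\<And>z. 0 \<le> A + z * y"
  shows "y = 0"
proof (rule ccontr)
  assume y: "y \<noteq> 0"
  have "0 \<le> A + (- (A + 1) / y) * y" by (rule assms)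
  thus False using y by simp
qed

context crossover
begin

abbreviation "Cd P i j \<equiv> C_design p t n Cov P i j"

text \<open>The vector \<open>(C12 + lam C22) f\<close>. The term subtracted in the information
  matrix is its outer product with itself, divided by \<open>f' C22 f\<close>.\<close>

definition "cross P lam f a = (\<Sum>b<t. (Cd P 1 2 $$ (a,b) + lam * Cd P 2 2 $$ (a,b)) * f b)"

definition "trC P i j = (\<Sum>a<t. Cd P i j $$ (a,a))"

text \<open>Trace of \<open>C11 + x (C12 + C21) + x^2 C22\<close>: the counterpart of
  \<open>n q_d(x)\<close> that still contains the correction for the means.\<close>

definition "qC P x = trC P 1 1 + 2 * x * trC P 1 2 + x\<^sup>2 * trC P 2 2"

lemma cross_eq_mbil:
  assumes "a < t"
  shows "cross P lam f a = mbil t (Cd P 1 2) (\<lambda>i. of_bool (i = a)) f + lam * mbil t (Cd P 2 2) (\<lambda>i. of_bool (i = a)) f"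
  unfolding cross_def mbil_unit_left[OF assms]
  by (simp add: algebra_simps sum.distrib sum_distrib_left)

section \<open>Entries, definiteness and trace of the information matrix\<close>

lemma info_mat_carrier [simp]: "info_mat p t n Cov P v lam \<in> carrier_mat t t"
  unfolding info_mat_def Let_def
  by (intro minus_carrier_mat) (auto intro!: smult_carrier_mat rank_one_sandwich_carrier simp del: assoc_mult_mat)

lemma info_mat_entry:
  assumes a: "a < t" and b: "b < t"
  shows "info_mat p t n Cov P (Matrix.vec t f) lam $$ (a,b) =
    Cd P 1 1 $$ (a,b) + lam * (Cd P 1 2 $$ (a,b) + Cd P 2 1 $$ (a,b)) + lam\<^sup>2 * Cd P 2 2 $$ (a,b)
    - cross P lam f a * cross P lam f b / mbil t (Cd P 2 2) f f"
proof -
  define c where "c = mat_of_cols t [Matrix.vec t f]"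
  define M where "M = Cd P 1 2 + lam \<cdot>\<^sub>m Cd P 2 2"
  define N where "N = Cd P 2 1 + lam \<cdot>\<^sub>m Cd P 2 2"
  define q where "q = mbil t (Cd P 2 2) f f"
  note car = carrier_matD[OF C_design_carrier]
  have M: "M \<in> carrier_mat t t" and N: "N \<in> carrier_mat t t"
    unfolding M_def N_def by auto
  define X where "X = M * c * transpose_mat c * N"
  have X: "X \<in> carrier_mat t t"
    unfolding X_def c_def by (rule rank_one_sandwich_carrier[OF M N])
  have "(\<Sum>j<t. M $$ (a,j) * f j) = cross P lam f a"
    unfolding M_def cross_def using a by (simp add: car)
  moreover have "(\<Sum>j<t. f j * N $$ (j,b)) = cross P lam f b"
    unfolding N_def cross_def using b
    by (intro sum.cong) (simp_all add: car C_design_swap[of _ b P 2 1] C_design_swap[of _ b P 2 2])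
  ultimately have "X $$ (a,b) = cross P lam f a * cross P lam f b"
    using rank_one_sandwich_entry[OF M N a b, of f] unfolding X_def c_def by simp
  \<comment> \<open>The case distinction disappears because division by 0 yields 0.\<close>
  hence "(if q = 0 then 0\<^sub>m t t else (1 / q) \<cdot>\<^sub>m X) $$ (a,b) =
     cross P lam f a * cross P lam f b / q"
    using X a b by auto
  moreover have "(if q = 0 then 0\<^sub>m t t else (1 / q) \<cdot>\<^sub>m X) \<in> carrier_mat t t"
    using X by auto
  ultimately show ?thesis
    using a b unfolding info_mat_def Let_def mbil_scalar_prod[OF C_design_carrier]
      c_def[symmetric] M_def[symmetric] N_def[symmetric] q_def[symmetric] X_def[symmetric]
    by (auto simp: car simp del: index_mult_mat)
qed

text \<open>The joint form at \<open>(u, lam u + z f)\<close>, read as a polynomial in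
  \<open>z\<close>. Its linear coefficient is twice the pairing of \<open>u\<close> with
  \<open>cross\<close>, so suitable values of \<open>z\<close> give the Schur complement and its
  degenerate case.\<close>

lemma mbil_Cd_form_nonneg:
  assumes P: "is_design p t P"
  shows "0 \<le> mbil t (Cd P 1 1) u u + 2 * lam * mbil t (Cd P 1 2) u u + lam\<^sup>2 * mbil t (Cd P 2 2) u u
     + 2 * z * (mbil t (Cd P 1 2) u f + lam * mbil t (Cd P 2 2) u f) + z\<^sup>2 * mbil t (Cd P 2 2) f f"
proof -
  have sym: "mbil t (Cd P 2 2) f u = mbil t (Cd P 2 2) u f"
    by (intro mbil_commute C_design_swap)
  show ?thesis
    using C_design_psd[OF P, of u "\<lambda>k. lam * u k + z * f k"]
    unfolding mbil_lin_left mbil_lin_right sym by (simp add: algebra_simps power2_eq_square)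
qed

lemma mbil_Cd22_nonneg: "is_design p t P \<Longrightarrow> 0 \<le> mbil t (Cd P 2 2) f f"
  using C_design_psd[of P "\<lambda>_. 0" f] by (simp add: mbil_zero_left)

text \<open>When the quadratic coefficient in \<open>z\<close> vanishes, an affine function of
  \<open>z\<close> is bounded below, so its slope, twice the entry of \<open>cross\<close>, is 0.
  Hence nothing is lost where the information matrix drops its last term.\<close>

lemma cross_eq_0:
  assumes P: "is_design p t P" and a: "a < t" and f: "mbil t (Cd P 2 2) f f = 0"
  shows "cross P lam f a = 0"
proof -
  define A where "A = (let e = \<lambda>i. of_bool (i = a) in 
    mbil t (Cd P 1 1) e e + 2 * lam * mbil t (Cd P 1 2) e e + lam\<^sup>2 * mbil t (Cd P 2 2) e e)"
  have "0 \<le> A + z * (2 * cross P lam f a)" for z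
    using mbil_Cd_form_nonneg[OF P, of "\<lambda>i. of_bool (i = a)" lam z f]
    unfolding f A_def Let_def cross_eq_mbil[OF a] by (simp add: algebra_simps)
  thus ?thesis using affine_nonneg_imp_slope_0[of A "2 * cross P lam f a"] by simp
qed

lemma sum_cross: "(\<Sum>a<t. cross P lam f a) = 0"
proof -
  have col: "(\<Sum>a<t. Cd P i j $$ (a,b)) = 0" if "b < t" for i j b
    using C_design_row_sum[OF that, of P j i] that by (simp add: C_design_swap[of _ b P i j])
  have "(\<Sum>a<t. cross P lam f a) = (\<Sum>b<t. \<Sum>a<t. (Cd P 1 2 $$ (a,b) + lam * Cd P 2 2 $$ (a,b)) * f b)"
    unfolding cross_def by (rule sum.swap)
  also have "\<dots> = (\<Sum>b<t. ((\<Sum>a<t. Cd P 1 2 $$ (a,b)) + lam * (\<Sum>a<t. Cd P 2 2 $$ (a,b))) * f b)"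
    by (simp add: sum.distrib sum_distrib_left sum_distrib_right distrib_right)
  also have "\<dots> = 0" by (simp add: col)
  finally show ?thesis .
qed

lemma info_mat_psd:
  assumes P: "is_design p t P"
  shows "0 \<le> (\<Sum>a<t. \<Sum>b<t. u a * info_mat p t n Cov P (Matrix.vec t f) lam $$ (a,b) * u b)"
proof -
  define c where "c = mbil t (Cd P 2 2) f f"
  define y where "y = (\<Sum>a<t. u a * cross P lam f a)"
  have y: "y = mbil t (Cd P 1 2) u f + lam * mbil t (Cd P 2 2) u f"
    unfolding y_def cross_def mbil_def
    by (simp add: sum_distrib_left sum_distrib_right sum.distrib algebra_simps)
  have s: "mbil t (Cd P 2 1) u u = mbil t (Cd P 1 2) u u"
  proof -
    have "mbil t (Cd P 2 1) u u = (\<Sum>l<t. \<Sum>k<t. u k * Cd P 2 1 $$ (k,l) * u l)"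
      unfolding mbil_def by (rule sum.swap)
    also have "\<dots> = mbil t (Cd P 1 2) u u"
      unfolding mbil_def by (intro sum.cong) (auto simp: C_design_swap[of _ _ P 2 1])
    finally show ?thesis .
  qed
  have yy: "(\<Sum>a<t. \<Sum>b<t. u a * cross P lam f a * (u b * cross P lam f b)) = y\<^sup>2"
    unfolding y_def power2_eq_square sum_product ..
  have "(\<Sum>a<t. \<Sum>b<t. u a * info_mat p t n Cov P (Matrix.vec t f) lam $$ (a,b) * u b) =
    (\<Sum>a<t. \<Sum>b<t. u a * Cd P 1 1 $$ (a,b) * u b + lam * (u a * Cd P 1 2 $$ (a,b) * u b)
      + lam * (u a * Cd P 2 1 $$ (a,b) * u b) + lam\<^sup>2 * (u a * Cd P 2 2 $$ (a,b) * u b)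
      - u a * cross P lam f a * (u b * cross P lam f b) / c)"
    by (intro sum.cong refl) (simp add: info_mat_entry c_def algebra_simps)
  also have "\<dots> = mbil t (Cd P 1 1) u u + lam * mbil t (Cd P 1 2) u u + lam * mbil t (Cd P 2 1) u u
      + lam\<^sup>2 * mbil t (Cd P 2 2) u u - y\<^sup>2 / c"
    unfolding mbil_def yy[symmetric]
    by (simp add: sum_subtractf sum.distrib sum_distrib_left sum_divide_distrib)
  \<comment> \<open>For positive \<open>c\<close> the value \<open>z = - y / c\<close> minimises the
    polynomial in \<open>z\<close>. If \<open>c = 0\<close>, both quotients are 0 and the two sides
    still agree.\<close>
  also have "\<dots> = mbil t (Cd P 1 1) u u + 2 * lam * mbil t (Cd P 1 2) u u + lam\<^sup>2 * mbil t (Cd P 2 2) u u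
     + 2 * (- y / c) * y + (- y / c)\<^sup>2 * c"
    unfolding s by (cases "c = 0") (simp_all add: power2_eq_square field_simps)
  also have "\<dots> \<ge> 0"
    using mbil_Cd_form_nonneg[OF P, of u lam "- y / c" f] unfolding y[symmetric] c_def[symmetric] .
  finally show ?thesis .
qed

lemma trC_swap: "trC P i j = trC P j i"
  unfolding trC_def by (intro sum.cong) (auto simp: C_design_swap[of _ _ P i j])

lemma info_mat_trace:
  "(\<Sum>a<t. info_mat p t n Cov P (Matrix.vec t f) lam $$ (a,a)) =
    qC P lam - (\<Sum>a<t. (cross P lam f a)\<^sup>2) / mbil t (Cd P 2 2) f f"
proof -
  have "(\<Sum>a<t. info_mat p t n Cov P (Matrix.vec t f) lam $$ (a,a)) =
    (\<Sum>a<t. Cd P 1 1 $$ (a,a) + lam * (Cd P 1 2 $$ (a,a) + Cd P 2 1 $$ (a,a)) + lam\<^sup>2 * Cd P 2 2 $$ (a,a)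
      - (cross P lam f a)\<^sup>2 / mbil t (Cd P 2 2) f f)"
    by (intro sum.cong) (auto simp: info_mat_entry power2_eq_square)
  also have "\<dots> = trC P 1 1 + lam * (trC P 1 2 + trC P 2 1) + lam\<^sup>2 * trC P 2 2
      - (\<Sum>a<t. (cross P lam f a)\<^sup>2) / mbil t (Cd P 2 2) f f"
    unfolding trC_def
    by (simp add: sum.distrib sum_subtractf sum_distrib_left sum_divide_distrib distrib_left)
  finally show ?thesis unfolding trC_swap[of P 2 1] qC_def by simp
qed

lemma Phi_T_info_mat:
  assumes P: "is_design p t P"
  shows "Phi_T t (info_mat p t n Cov P (Matrix.vec t f) lam) =
    (qC P lam - (\<Sum>a<t. (cross P lam f a)\<^sup>2) / mbil t (Cd P 2 2) f f) / (real t - 1)"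
proof -
  let ?I = "info_mat p t n Cov P (Matrix.vec t f) lam"
  have sym: "?I $$ (a,b) = ?I $$ (b,a)" if "a < t" "b < t" for a b
    using that by (simp add: info_mat_entry C_design_swap[of a b] algebra_simps)
  have rows: "(\<Sum>b<t. ?I $$ (a,b)) = 0" if a: "a < t" for a
  proof -
    have "(\<Sum>b<t. ?I $$ (a,b)) = (\<Sum>b<t. Cd P 1 1 $$ (a,b)) + lam * ((\<Sum>b<t. Cd P 1 2 $$ (a,b)) + (\<Sum>b<t. Cd P 2 1 $$ (a,b)))
      + lam\<^sup>2 * (\<Sum>b<t. Cd P 2 2 $$ (a,b)) - cross P lam f a * (\<Sum>b<t. cross P lam f b) / mbil t (Cd P 2 2) f f"
      using a by (simp add: info_mat_entry sum.distrib sum_subtractf sum_distrib_left sum_divide_distrib distrib_left)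
    thus ?thesis using C_design_row_sum[OF a] sum_cross by simp
  qed
  thus ?thesis
    using Phi_T_eq_trace[OF t info_mat_carrier sym info_mat_psd[OF P] rows] by (simp add: info_mat_trace)
qed

lemma info_trace_nonneg:
  assumes P: "is_design p t P"
  shows "0 \<le> qC P lam - (\<Sum>a<t. (cross P lam f a)\<^sup>2) / mbil t (Cd P 2 2) f f"
proof -
  let ?I = "info_mat p t n Cov P (Matrix.vec t f) lam"
  have "0 \<le> ?I $$ (a,a)" if "a < t" for a
    using info_mat_psd[OF P, of "\<lambda>i. of_bool (i = a)" f lam] mbil_unit_left[OF that, of ?I "\<lambda>i. of_bool (i = a)"] that
    unfolding mbil_def sum_of_bool_eq(4)[OF that] by simp
  hence "0 \<le> (\<Sum>a<t. ?I $$ (a,a))" by (intro sum_nonneg) auto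
  thus ?thesis by (simp add: info_mat_trace)
qed

text \<open>The squared length of \<open>cross + z c f\<close>, divided by
  \<open>c = f' C22 f\<close>, is nonnegative. Equality requires \<open>cross\<close> to be the
  multiple \<open>- z c f\<close> of \<open>f\<close>. If \<open>c = 0\<close>, then
  \<open>cross\<close> vanishes and both sides coincide.\<close>

lemma info_trace_le:
  assumes P: "is_design p t P"
  shows "qC P lam - (\<Sum>a<t. (cross P lam f a)\<^sup>2) / mbil t (Cd P 2 2) f f
    \<le> qC P lam + 2 * z * (\<Sum>a<t. cross P lam f a * f a) + z\<^sup>2 * (\<Sum>a<t. (f a)\<^sup>2) * mbil t (Cd P 2 2) f f"
proof (cases "mbil t (Cd P 2 2) f f = 0")
  case True
  thus ?thesis using cross_eq_0[OF P _ True] by simp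
next
  case False
  define c where "c = mbil t (Cd P 2 2) f f"
  have c: "c > 0" using False mbil_Cd22_nonneg[OF P, of f] unfolding c_def by simp
  have "0 \<le> (\<Sum>a<t. (cross P lam f a + z * c * f a)\<^sup>2) / c"
    using c by (intro divide_nonneg_nonneg sum_nonneg) auto
  also have "\<dots> = (\<Sum>a<t. (cross P lam f a)\<^sup>2) / c + 2 * z * (\<Sum>a<t. cross P lam f a * f a) + z\<^sup>2 * (\<Sum>a<t. (f a)\<^sup>2) * c"
    using c unfolding sum_divide_distrib sum_distrib_left sum_distrib_right sum.distrib[symmetric]
    by (intro sum.cong) (simp_all add: power2_eq_square field_simps)
  finally show ?thesis unfolding c_def by simp
qed

end

section \<open>Balanced designs\<close>

text \<open>Double transitivity: swap 0 with \<open>a\<close>, then the current image of 1 with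
  \<open>b\<close>. The second swap fixes \<open>a\<close>, since neither of its two points is
  \<open>a\<close>.\<close>

lemma ex_permutes_pair:
  assumes "a < t" "b < t" "a \<noteq> b" "1 < (t::nat)"
  shows "\<exists>\<pi>. \<pi> permutes {..<t} \<and> \<pi> 0 = a \<and> \<pi> 1 = b"
proof -
  define \<sigma> where "\<sigma> = Transposition.transpose 0 a"
  have \<sigma>: "\<sigma> permutes {..<t}" unfolding \<sigma>_def using assms by (intro permutes_swap_id) auto
  have \<sigma>0: "\<sigma> 0 = a" unfolding \<sigma>_def by simp
  have "\<sigma> 1 \<noteq> \<sigma> 0" using inj_eq[OF permutes_inj[OF \<sigma>]] by simp
  hence \<sigma>1: "\<sigma> 1 \<noteq> a" using \<sigma>0 by simp
  have "\<sigma> 1 < t" using permutes_in_image[OF \<sigma>, of 1] assms(4) by simp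
  hence "Transposition.transpose b (\<sigma> 1) permutes {..<t}" using assms by (intro permutes_swap_id) auto
  hence "Transposition.transpose b (\<sigma> 1) \<circ> \<sigma> permutes {..<t}" using \<sigma> by (rule permutes_compose[rotated])
  thus ?thesis using \<sigma>0 \<sigma>1 assms(3) by (intro exI[of _ "Transposition.transpose b (\<sigma> 1) \<circ> \<sigma>"]) (simp add: Transposition.transpose_def)
qed

text \<open>Pairs of indices form two orbits, the diagonal and the rest, represented by
  \<open>(0,0)\<close> and \<open>(0,1)\<close>. The lemma serves twice: for orbit designs and for
  the second moments of the prior direction.\<close>

lemma permutation_invariant_matrix:
  fixes M :: "nat \<Rightarrow> nat \<Rightarrow> real"
  assumes "1 < t" and inv: "\<And>\<pi> a b. \<pi> permutes {..<t} \<Longrightarrow> a < t \<Longrightarrow> b < t \<Longrightarrow> M (\<pi> a) (\<pi> b) = M a b"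
    and a: "a < t" and b: "b < t"
  shows "M a b = (M 0 0 - M 0 1) * of_bool (a = b) + M 0 1"
proof (cases "a = b")
  case True
  have "Transposition.transpose 0 a permutes {..<t}" using a by (intro permutes_swap_id) auto
  from inv[OF this, of 0 0] show ?thesis using True a by simp
next
  case False
  obtain \<pi> where "\<pi> permutes {..<t}" "\<pi> 0 = a" "\<pi> 1 = b"
    using ex_permutes_pair[OF a b False] assms(1) by blast
  thus ?thesis using inv[of \<pi> 0 1] assms(1) False by simp
qed

text \<open>The distribution of a uniformly random relabeling of \<open>s\<close>. Summing over
  permutations instead of distinct images makes the normalisation \<open>fact t\<close> correct also
  when different permutations give the same sequence.\<close>

definition orbit_design :: "nat \<Rightarrow> nat list \<Rightarrow> nat list \<Rightarrow> real" where
  "orbit_design t s = (\<lambda>s'. (\<Sum>\<pi> | \<pi> permutes {..<t}. of_bool (map \<pi> s = s')) / fact t)"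

lemma map_permutes_seqs: "s \<in> seqs p t \<Longrightarrow> \<pi> permutes {..<t} \<Longrightarrow> map \<pi> s \<in> seqs p t"
  unfolding seqs_def using permutes_in_image[of \<pi> "{..<t}"] by auto

lemma orbit_design_sum:
  assumes "s \<in> seqs p t"
  shows "(\<Sum>s'\<in>seqs p t. orbit_design t s s' * F s') = (\<Sum>\<pi> | \<pi> permutes {..<t}. F (map \<pi> s)) / fact t"
proof -
  have "(\<Sum>s'\<in>seqs p t. orbit_design t s s' * F s') =
      (\<Sum>s'\<in>seqs p t. \<Sum>\<pi> | \<pi> permutes {..<t}. of_bool (map \<pi> s = s') * F s' / fact t)"
    unfolding orbit_design_def sum_divide_distrib sum_distrib_right by simp
  also have "\<dots> = (\<Sum>\<pi> | \<pi> permutes {..<t}. \<Sum>s'\<in>seqs p t. of_bool (map \<pi> s = s') * F s' / fact t)"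
    by (rule sum.swap)
  also have "\<dots> = (\<Sum>\<pi> | \<pi> permutes {..<t}. F (map \<pi> s) / fact t)"
  proof (intro sum.cong refl)
    fix \<pi> assume "\<pi> \<in> {\<pi>. \<pi> permutes {..<t}}"
    hence m: "map \<pi> s \<in> seqs p t" using map_permutes_seqs[OF assms] by blast
    have "(\<Sum>s'\<in>seqs p t. of_bool (map \<pi> s = s') * F s' / fact t) = 
        (\<Sum>s'\<in>seqs p t. if map \<pi> s = s' then F s' / fact t else 0)"
      by (intro sum.cong) auto
    thus "(\<Sum>s'\<in>seqs p t. of_bool (map \<pi> s = s') * F s' / fact t) = F (map \<pi> s) / fact t"
      using m by simp
  qed
  finally show ?thesis by (simp add: sum_divide_distrib)
qed

lemma orbit_design_is_design:
  assumes "s \<in> seqs p t"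
  shows "is_design p t (orbit_design t s)"
proof -
  have "(\<Sum>s'\<in>seqs p t. orbit_design t s s') = 1"
    using orbit_design_sum[OF assms, of "\<lambda>_. 1"] card_permutations[of "{..<t}" t] by simp
  thus ?thesis unfolding is_design_def orbit_design_def by (auto intro!: divide_nonneg_nonneg sum_nonneg)
qed

lemma effect_map:
  assumes s: "s \<in> seqs p t" and \<pi>: "\<pi> permutes {..<t}" and k: "k < p"
  shows "effect t i (map \<pi> s) (\<pi> a) k = effect t i s a k"
proof -
  have "length s = p" using s unfolding seqs_def by simp
  thus ?thesis using k inj_eq[OF permutes_inj[OF \<pi>]] by (simp add: effect_def)
qed

context crossover
begin

text \<open>Both conditions are linear in \<open>P\<close>, so mixtures of balanced designs are balanced.\<close>

definition "balanced P \<longleftrightarrow> (\<forall>i\<in>{1,2}. \<forall>a<t. \<forall>k<p. mean P i a k = 0) \<and>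
  (\<forall>i\<in>{1,2}. \<forall>j\<in>{1,2}. \<exists>\<alpha> \<beta>. \<forall>a<t. \<forall>b<t. 
     (\<Sum>s\<in>seqs p t. P s * bil (eff i s a) (eff j s b)) = \<alpha> * of_bool (a = b) + \<beta>)"

lemma trC_eq:
  "trC P i j = real n * ((\<Sum>s\<in>seqs p t. P s * c_seq p t Cov s i j) - (\<Sum>a<t. bil (mean P i a) (mean P j a)))"
proof -
  have "trC P i j = (\<Sum>a<t. real n * ((\<Sum>s\<in>seqs p t. P s * bil (eff i s a) (eff j s a)) - bil (mean P i a) (mean P j a)))"
    unfolding trC_def by (intro sum.cong) (auto simp: C_design_entry)
  also have "\<dots> = real n * ((\<Sum>a<t. \<Sum>s\<in>seqs p t. P s * bil (eff i s a) (eff j s a)) - (\<Sum>a<t. bil (mean P i a) (mean P j a)))"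
    by (simp add: sum_subtractf flip: sum_distrib_left)
  also have "(\<Sum>a<t. \<Sum>s\<in>seqs p t. P s * bil (eff i s a) (eff j s a)) = (\<Sum>s\<in>seqs p t. \<Sum>a<t. P s * bil (eff i s a) (eff j s a))"
    by (rule sum.swap)
  also have "\<dots> = (\<Sum>s\<in>seqs p t. P s * c_seq p t Cov s i j)"
    by (intro sum.cong) (auto simp: c_seq_eq sum_distrib_left)
  finally show ?thesis .
qed

lemma q_design_expand:
  "q_design p t Cov P x = (\<Sum>s\<in>seqs p t. P s * c_seq p t Cov s 1 1)
     + 2 * x * (\<Sum>s\<in>seqs p t. P s * c_seq p t Cov s 1 2) + x\<^sup>2 * (\<Sum>s\<in>seqs p t. P s * c_seq p t Cov s 2 2)"
  unfolding q_design_def q_seq_def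
  by (simp add: sum.distrib sum_distrib_left algebra_simps)

text \<open>The difference is \<open>n\<close> times a sum of squared \<open>B_tilde\<close>
  lengths, namely those of the mean direct effect plus \<open>x\<close> times the mean carryover
  effect.\<close>

lemma qC_le: "qC P x \<le> real n * q_design p t Cov P x"
proof -
  have sq: "bil (\<lambda>k. mean P 1 a k + x * mean P 2 a k) (\<lambda>k. mean P 1 a k + x * mean P 2 a k) =
     bil (mean P 1 a) (mean P 1 a) + 2 * x * bil (mean P 1 a) (mean P 2 a) + x\<^sup>2 * bil (mean P 2 a) (mean P 2 a)" for a
    unfolding mbil_lin_left[where a = 1, simplified] mbil_lin_right[where a = 1, simplified]
    by (simp add: bil_commute[of "mean P 2 a" "mean P 1 a"] algebra_simps power2_eq_square)
  have "0 \<le> (\<Sum>a<t. bil (\<lambda>k. mean P 1 a k + x * mean P 2 a k) (\<lambda>k. mean P 1 a k + x * mean P 2 a k))"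
    by (intro sum_nonneg bil_nonneg)
  hence "0 \<le> real n * ((\<Sum>a<t. bil (mean P 1 a) (mean P 1 a)) + 2 * x * (\<Sum>a<t. bil (mean P 1 a) (mean P 2 a)) 
    + x\<^sup>2 * (\<Sum>a<t. bil (mean P 2 a) (mean P 2 a)))"
    unfolding sq by (simp add: sum.distrib sum_distrib_left)
  thus ?thesis unfolding qC_def trC_eq q_design_expand by (simp add: algebra_simps)
qed

lemma balanced_mean: "balanced P \<Longrightarrow> i \<in> {1,2} \<Longrightarrow> a < t \<Longrightarrow> k < p \<Longrightarrow> mean P i a k = 0"
  unfolding balanced_def by blast

lemma balanced_bil_mean:
  assumes "balanced P" "i \<in> {1,2}" "j \<in> {1,2}" "a < t" "b < t"
  shows "bil (mean P i a) (mean P j b) = 0"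
proof -
  have "bil (mean P i a) (mean P j b) = bil (\<lambda>_. 0) (\<lambda>_. 0)"
    using assms by (intro mbil_cong balanced_mean)
  thus ?thesis by (simp add: mbil_zero_left)
qed

lemma balanced_trC:
  assumes "balanced P" "i \<in> {1,2}" "j \<in> {1,2}"
  shows "trC P i j = c_design p t n Cov P i j"
  unfolding trC_eq c_design_def using balanced_bil_mean[OF assms] by simp

lemma balanced_qC:
  assumes "balanced P"
  shows "qC P x = real n * q_design p t Cov P x"
  unfolding qC_def q_design_expand using balanced_trC[OF assms] by (simp add: c_design_def algebra_simps)

text \<open>A completely symmetric matrix with zero row sums is a multiple of \<open>B_mat\<close>,
  whose trace is \<open>t - 1\<close>; so the trace fixes the multiple.\<close>

lemma balanced_Cd:
  assumes bal: "balanced P" and ij: "i \<in> {1,2}" "j \<in> {1,2}" and ab: "a < t" "b < t"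
  shows "Cd P i j $$ (a,b) = trC P i j / (real t - 1) * (of_bool (a = b) - 1 / real t)"
proof -
  obtain \<alpha> \<beta> where "\<forall>a<t. \<forall>b<t. 
     (\<Sum>s\<in>seqs p t. P s * bil (eff i s a) (eff j s b)) = \<alpha> * of_bool (a = b) + \<beta>"
    using bal ij unfolding balanced_def by meson
  hence e: "Cd P i j $$ (a,b) = real n * (\<alpha> * of_bool (a = b) + \<beta>)" if "a < t" "b < t" for a b
    using that balanced_bil_mean[OF bal ij that] by (simp add: C_design_entry)
  have "real n * (\<alpha> + real t * \<beta>) = (\<Sum>b<t. Cd P i j $$ (0,b))"
    using t by (simp add: e sum_distrib_left[symmetric] sum.distrib sum_of_bool_eq)
  also have "\<dots> = 0" using t by (intro C_design_row_sum) simp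
  finally have "\<alpha> + real t * \<beta> = 0" using n by simp
  hence \<beta>: "\<beta> = - \<alpha> / real t" using t by (simp add: field_simps)
  have "trC P i j = real n * (real t * \<alpha> + real t * \<beta>)"
    unfolding trC_def by (simp add: e algebra_simps)
  also have "real t * \<beta> = - \<alpha>" unfolding \<beta> using t by simp
  finally have "trC P i j = real n * \<alpha> * (real t - 1)" by (simp add: algebra_simps)
  hence "trC P i j / (real t - 1) = real n * \<alpha>" using t by simp
  thus ?thesis using e[OF ab] unfolding \<beta> by (simp add: field_simps)
qed

text \<open>Equal replication makes all means vanish; the carryover mean in a later period is the
  direct mean one period before. With the correction gone, complete symmetry of
  \<open>C_design\<close> becomes a condition on the linear part.\<close>

lemma pseudo_symmetric_balanced:
  assumes P: "is_design p t P" and ps: "pseudo_symmetric p t n Cov P"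
  shows "balanced P"
proof -
  have rep: "(\<Sum>s\<in>seqs p t. P s * of_bool (s ! k = a)) = 1 / real t" if "k < p" "a < t" for k a
  proof -
    have "(\<Sum>s\<in>seqs p t. P s * of_bool (s ! k = a)) = (\<Sum>s\<in>seqs p t. if s ! k = a then P s else 0)"
      by (intro sum.cong) auto
    also have "\<dots> = (\<Sum>s | s \<in> seqs p t \<and> s ! k = a. P s)"
      by (subst sum.inter_filter[symmetric]) simp_all
    finally show ?thesis using ps that unfolding pseudo_symmetric_def by simp
  qed
  have tot: "(\<Sum>s\<in>seqs p t. P s) = 1" using P unfolding is_design_def by simp
  have c: "(\<Sum>s\<in>seqs p t. P s * (of_bool (s ! k = a) - 1 / real t)) = 0" if "k < p" "a < t" for k a
    using rep[OF that] tot by (simp add: right_diff_distrib sum_subtractf flip: sum_divide_distrib)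
  have mean0: "mean P i a k = 0" if "a < t" "k < p" for i a k
    using that c[of k a] c[of "k - 1" a]
    by (cases "i = 1"; cases "k = 0") (simp_all add: mean_def effect_def)
  have bil0: "bil (mean P i a) (mean P j b) = 0" if "a < t" "b < t" for i j a b
  proof -
    have "bil (mean P i a) (mean P j b) = bil (\<lambda>_. 0) (\<lambda>_. 0)"
      using that mean0 by (intro mbil_cong) auto
    thus ?thesis by (simp add: mbil_zero_left)
  qed
  have ex: "\<exists>\<alpha> \<beta>. \<forall>a<t. \<forall>b<t. 
     (\<Sum>s\<in>seqs p t. P s * bil (eff i s a) (eff j s b)) = \<alpha> * of_bool (a = b) + \<beta>"
    if ij: "i \<in> {1,2}" "j \<in> {1,2}" for i j
  proof -
    obtain \<alpha> \<beta> where ab: "Cd P i j = \<alpha> \<cdot>\<^sub>m 1\<^sub>m t + \<beta> \<cdot>\<^sub>m J_mat t"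
      using ps ij unfolding pseudo_symmetric_def completely_symmetric_def by meson
    have "(\<Sum>s\<in>seqs p t. P s * bil (eff i s a) (eff j s b)) = \<alpha> / real n * of_bool (a = b) + \<beta> / real n"
      if "a < t" "b < t" for a b
    proof -
      have "real n * (\<Sum>s\<in>seqs p t. P s * bil (eff i s a) (eff j s b)) = Cd P i j $$ (a,b)"
        using that by (simp add: C_design_entry bil0)
      also have "\<dots> = \<alpha> * of_bool (a = b) + \<beta>"
        unfolding ab using that by (simp add: J_mat_def)
      finally show ?thesis using n by (simp add: field_simps)
    qed
    thus ?thesis by blast
  qed
  show ?thesis unfolding balanced_def
    by (intro conjI ballI allI impI; (rule mean0 ex; assumption))
qed

section \<open>The parabola of a design and its vertex \<open>x_design\<close>\<close>

lemma c_design_22_pos: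
  assumes P: "is_design p t P"
  shows "0 < c_design p t n Cov P 2 2"
proof -
  have "\<exists>s\<in>seqs p t. P s \<noteq> 0"
  proof (rule ccontr)
    assume "\<not> ?thesis"
    hence "(\<Sum>s\<in>seqs p t. P s) = 0" by simp
    thus False using P unfolding is_design_def by simp
  qed
  then obtain s where s: "s \<in> seqs p t" "P s \<noteq> 0" by blast
  hence "P s > 0" using P unfolding is_design_def by force
  hence "0 < P s * c_seq p t Cov s 2 2" using c_seq_22_pos[OF s(1)] by simp
  moreover have "0 \<le> P s * c_seq p t Cov s 2 2" if "s \<in> seqs p t" for s
    using P that less_imp_le[OF c_seq_22_pos[OF that]] unfolding is_design_def by simp
  ultimately have "0 < (\<Sum>s\<in>seqs p t. P s * c_seq p t Cov s 2 2)"
    using s(1) by (intro sum_pos2[of _ s]) auto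
  thus ?thesis unfolding c_design_def using n by simp
qed

lemma q_design_complete_square:
  assumes P: "is_design p t P"
  defines "xd \<equiv> x_design p t n Cov P"
  shows "real n * q_design p t Cov P y = real n * q_design p t Cov P xd + c_design p t n Cov P 2 2 * (y - xd)\<^sup>2"
proof -
  have pos: "0 < c_design p t n Cov P 2 2" by (rule c_design_22_pos[OF P])
  have e: "real n * q_design p t Cov P y = c_design p t n Cov P 1 1 + 2 * y * c_design p t n Cov P 1 2 + y\<^sup>2 * c_design p t n Cov P 2 2" for y
    unfolding q_design_expand c_design_def by (simp add: algebra_simps)
  have c12: "c_design p t n Cov P 1 2 = - xd * c_design p t n Cov P 2 2"
    unfolding xd_def x_design_def using pos by simp
  show ?thesis unfolding e c12 by (simp add: power2_eq_square algebra_simps)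
qed

lemma q_design_x_design_le:
  assumes P: "is_design p t P"
  shows "q_design p t Cov P (x_design p t n Cov P) \<le> q_design p t Cov P y"
proof -
  have "0 \<le> c_design p t n Cov P 2 2 * (y - x_design p t n Cov P)\<^sup>2"
    using c_design_22_pos[OF P] by simp
  hence "real n * q_design p t Cov P (x_design p t n Cov P) \<le> real n * q_design p t Cov P y"
    using q_design_complete_square[OF P, of y] by linarith
  thus ?thesis using n by simp
qed

section \<open>Relabelings of the treatments, orbit designs and mixtures\<close>

lemma q_seq_map:
  assumes s: "s \<in> seqs p t" and \<pi>: "\<pi> permutes {..<t}"
  shows "q_seq p t Cov (map \<pi> s) x = q_seq p t Cov s x"
proof -
  let ?f = "\<lambda>s a. bil (\<lambda>k. eff 1 s a k + x * eff 2 s a k) (\<lambda>k. eff 1 s a k + x * eff 2 s a k)"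
  have "(\<Sum>a<t. ?f (map \<pi> s) a) = (\<Sum>a<t. ?f (map \<pi> s) (\<pi> a))"
    using sum.permute[OF \<pi>, of "?f (map \<pi> s)"] by (simp add: o_def)
  also have "\<dots> = (\<Sum>a<t. ?f s a)"
    by (intro sum.cong mbil_cong refl) (simp_all add: effect_map[OF s \<pi>])
  finally show ?thesis
    unfolding q_seq_eq[OF s] q_seq_eq[OF map_permutes_seqs[OF s \<pi>]] .
qed

lemma orbit_q_design:
  assumes s: "s \<in> seqs p t"
  shows "q_design p t Cov (orbit_design t s) x = q_seq p t Cov s x"
proof -
  have "(\<Sum>\<pi> | \<pi> permutes {..<t}. q_seq p t Cov (map \<pi> s) x) = (\<Sum>\<pi> | \<pi> permutes {..<t}. q_seq p t Cov s x)"
    by (intro sum.cong) (auto simp: q_seq_map[OF s])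
  thus ?thesis unfolding q_design_def orbit_design_sum[OF s]
    using card_permutations[of "{..<t}" t] by simp
qed

text \<open>Averaging over the group makes the means equal for all treatments, and they sum to zero,
  so they vanish. The averaged products are invariant under simultaneous relabeling of both
  treatments, which forces complete symmetry.\<close>

lemma orbit_balanced:
  assumes s: "s \<in> seqs p t"
  shows "balanced (orbit_design t s)"
proof -
  let ?S = "{\<pi>. \<pi> permutes {..<t}}"
  have mean0: "mean (orbit_design t s) i a k = 0" if a: "a < t" and k: "k < p" for i a k
  proof -
    define m where "m a = (\<Sum>\<pi>\<in>?S. eff i (map \<pi> s) a k)" for a
    have inv: "m (\<sigma> a) = m a" if \<sigma>: "\<sigma> permutes {..<t}" for \<sigma> a
    proof -
      \<comment> \<open>The sum over the group is reindexed by left composition with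
        \<open>\<sigma>\<close>; equivariance of the effects then removes
        \<open>\<sigma>\<close>.\<close>
      have "m (\<sigma> a) = (\<Sum>\<pi>\<in>?S. eff i (map (\<sigma> \<circ> \<pi>) s) (\<sigma> a) k)"
        unfolding m_def by (rule setum_permutations_compose_left[OF \<sigma>])
      also have "\<dots> = m a"
        unfolding m_def using effect_map[OF map_permutes_seqs[OF s] \<sigma> k]
        by (intro sum.cong) (simp_all flip: map_map)
      finally show ?thesis .
    qed
    have eq: "m b = m a" if "b < t" for b
      using inv[of "Transposition.transpose a b" a] permutes_swap_id[of a "{..<t}" b] a that by simp
    have "(\<Sum>b<t. m b) = (\<Sum>\<pi>\<in>?S. \<Sum>b<t. eff i (map \<pi> s) b k)"
      unfolding m_def by (rule sum.swap)
    also have "\<dots> = 0" by (simp add: sum_effect[OF map_permutes_seqs[OF s] k])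
    finally have "real t * m a = 0" by (simp add: eq)
    hence "m a = 0" using t by simp
    thus ?thesis unfolding mean_def orbit_design_sum[OF s] m_def by simp
  qed
  have ex: "\<exists>\<alpha> \<beta>. \<forall>a<t. \<forall>b<t. (\<Sum>s'\<in>seqs p t. orbit_design t s s' * bil (eff i s' a) (eff j s' b)) 
      = \<alpha> * of_bool (a = b) + \<beta>" for i j
  proof -
    define M where "M a b = (\<Sum>s'\<in>seqs p t. orbit_design t s s' * bil (eff i s' a) (eff j s' b))" for a b
    have M: "M a b = (\<Sum>\<pi>\<in>?S. bil (eff i (map \<pi> s) a) (eff j (map \<pi> s) b)) / fact t" for a b
      unfolding M_def by (rule orbit_design_sum[OF s])
    have "M (\<sigma> a) (\<sigma> b) = M a b" if \<sigma>: "\<sigma> permutes {..<t}" for \<sigma> a b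
    proof -
      have "(\<Sum>\<pi>\<in>?S. bil (eff i (map \<pi> s) (\<sigma> a)) (eff j (map \<pi> s) (\<sigma> b))) =
        (\<Sum>\<pi>\<in>?S. bil (eff i (map (\<sigma> \<circ> \<pi>) s) (\<sigma> a)) (eff j (map (\<sigma> \<circ> \<pi>) s) (\<sigma> b)))"
        by (rule setum_permutations_compose_left[OF \<sigma>])
      also have "\<dots> = (\<Sum>\<pi>\<in>?S. bil (eff i (map \<pi> s) a) (eff j (map \<pi> s) b))"
        using effect_map[OF map_permutes_seqs[OF s] \<sigma>]
        by (intro sum.cong mbil_cong refl) (simp_all flip: map_map)
      finally show ?thesis unfolding M by simp
    qed
    hence "M a b = (M 0 0 - M 0 1) * of_bool (a = b) + M 0 1" if "a < t" "b < t" for a b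
      using t that by (intro permutation_invariant_matrix[of t M]) auto
    thus ?thesis unfolding M_def[symmetric] by blast
  qed
  show ?thesis unfolding balanced_def
    by (intro conjI ballI allI impI; (rule ex | rule mean0; assumption))
qed

lemma mix_design:
  assumes "is_design p t P" "is_design p t U" "0 \<le> e" "e \<le> 1"
  shows "is_design p t (\<lambda>s. (1 - e) * P s + e * U s)"
  using assms unfolding is_design_def by (simp add: sum.distrib flip: sum_distrib_left)

lemma mix_q_design:
  "q_design p t Cov (\<lambda>s. (1 - e) * P s + e * U s) x = (1 - e) * q_design p t Cov P x + e * q_design p t Cov U x"
  unfolding q_design_def by (simp add: distrib_right sum.distrib sum_distrib_left mult.assoc)

lemma mix_balanced:
  assumes P: "balanced P" and U: "balanced U"
  shows "balanced (\<lambda>s. (1 - e) * P s + e * U s)"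
proof -
  have "mean (\<lambda>s. (1 - e) * P s + e * U s) i a k = (1 - e) * mean P i a k + e * mean U i a k" for i a k
    unfolding mean_def by (simp add: distrib_right sum.distrib sum_distrib_left mult.assoc)
  hence mean0: "mean (\<lambda>s. (1 - e) * P s + e * U s) i a k = 0" if "i \<in> {1,2}" "a < t" "k < p" for i a k
    using balanced_mean[OF P that] balanced_mean[OF U that] by simp
  have ex: "\<exists>\<alpha> \<beta>. \<forall>a<t. \<forall>b<t. 
     (\<Sum>s\<in>seqs p t. ((1 - e) * P s + e * U s) * bil (eff i s a) (eff j s b)) = \<alpha> * of_bool (a = b) + \<beta>"
    if ij: "i \<in> {1,2}" "j \<in> {1,2}" for i j
  proof -
    obtain \<alpha> \<beta> where 1: "\<forall>a<t. \<forall>b<t. (\<Sum>s\<in>seqs p t. P s * bil (eff i s a) (eff j s b)) = \<alpha> * of_bool (a = b) + \<beta>"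
      using P ij unfolding balanced_def by meson
    obtain \<gamma> \<delta> where 2: "\<forall>a<t. \<forall>b<t. (\<Sum>s\<in>seqs p t. U s * bil (eff i s a) (eff j s b)) = \<gamma> * of_bool (a = b) + \<delta>"
      using U ij unfolding balanced_def by meson
    have "(\<Sum>s\<in>seqs p t. ((1 - e) * P s + e * U s) * bil (eff i s a) (eff j s b)) = 
      ((1 - e) * \<alpha> + e * \<gamma>) * of_bool (a = b) + ((1 - e) * \<beta> + e * \<delta>)" if "a < t" "b < t" for a b
    proof -
      have "(\<Sum>s\<in>seqs p t. ((1 - e) * P s + e * U s) * bil (eff i s a) (eff j s b)) =
        (1 - e) * (\<Sum>s\<in>seqs p t. P s * bil (eff i s a) (eff j s b)) + e * (\<Sum>s\<in>seqs p t. U s * bil (eff i s a) (eff j s b))"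
        by (simp add: distrib_right sum.distrib sum_distrib_left mult.assoc)
      thus ?thesis using that 1 2 by (simp add: algebra_simps)
    qed
    thus ?thesis by blast
  qed
  show ?thesis unfolding balanced_def
    by (intro conjI ballI allI impI; (rule mean0 ex; assumption))
qed

end

section \<open>The criterion under an exchangeable prior\<close>

lemma abs_mult_div_sum_squares_le:
  fixes x :: "nat \<Rightarrow> real"
  assumes "a < t" "b < t"
  shows "\<bar>x a * x b / (\<Sum>c<t. (x c)\<^sup>2)\<bar> \<le> 1"
proof -
  have le: "(x c)\<^sup>2 \<le> (\<Sum>c<t. (x c)\<^sup>2)" if "c < t" for c
    using that by (intro member_le_sum) auto
  have "2 * \<bar>x a * x b\<bar> \<le> (x a)\<^sup>2 + (x b)\<^sup>2"
    using sum_squares_bound[of "\<bar>x a\<bar>" "\<bar>x b\<bar>"] by (simp add: abs_mult)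
  hence "\<bar>x a * x b\<bar> \<le> (\<Sum>c<t. (x c)\<^sup>2)" using le[OF assms(1)] le[OF assms(2)] by linarith
  moreover have "0 \<le> (\<Sum>c<t. (x c)\<^sup>2)" by (intro sum_nonneg) auto
  ultimately show ?thesis by (auto simp: abs_divide divide_le_eq_1)
qed

text \<open>Quotients are bounded by 1, hence integrable. Exchangeability leaves two unknowns, the
  diagonal and the off-diagonal value. They are determined by the diagonal sum, almost surely 1
  because \<open>x\<close> is nonzero, and by the sum of all entries, almost surely 0 because the
  coordinates of \<open>x\<close> sum to 0.\<close>

lemma
  assumes t: "t \<ge> 2" and prior: "is_prior t g" and exch: "exchangeable t g"
    and a: "a < t" and b: "b < t"
  shows integrable_prior_direction: "integrable g (\<lambda>x. x a * x b / (\<Sum>c<t. (x c)\<^sup>2))"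
    and integral_prior_direction:
      "(\<integral>x. x a * x b / (\<Sum>c<t. (x c)\<^sup>2) \<partial>g) = (of_bool (a = b) - 1 / real t) / (real t - 1)"
proof -
  interpret prob_space g using prior unfolding is_prior_def by simp
  have sets: "sets g = sets (Rt t)" using prior unfolding is_prior_def by simp
  have meas: "borel_measurable g = borel_measurable (Rt t)"
    by (rule measurable_cong_sets[OF sets refl])
  have comp: "(\<lambda>x. x c) \<in> borel_measurable (Rt t)" if "c < t" for c
    using that by (intro measurable_component_singleton) auto
  define f where "f a b = (\<lambda>x :: nat \<Rightarrow> real. x a * x b / (\<Sum>c<t. (x c)\<^sup>2))" for a b
  have f_meas: "f a b \<in> borel_measurable (Rt t)" if "a < t" "b < t" for a b
    unfolding f_def using that comp
    by (intro borel_measurable_divide borel_measurable_times borel_measurable_sum borel_measurable_power) auto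
  have int: "integrable g (f a b)" if "a < t" "b < t" for a b
  proof (rule integrable_const_bound[of _ 1])
    show "AE x in g. norm (f a b x) \<le> 1"
      unfolding f_def real_norm_def using abs_mult_div_sum_squares_le[OF that] by blast
    show "f a b \<in> borel_measurable g" unfolding meas by (rule f_meas[OF that])
  qed
  thus "integrable g (\<lambda>x. x a * x b / (\<Sum>c<t. (x c)\<^sup>2))" using a b unfolding f_def by blast
  define M where "M a b = (\<integral>x. f a b x \<partial>g)" for a b
  have inv: "M (\<pi> a) (\<pi> b) = M a b" if \<pi>: "\<pi> permutes {..<t}" and ab: "a < t" "b < t" for \<pi> a b
  proof -
    define T where "T x = (\<lambda>i\<in>{..<t}. x (\<pi> i))" for x :: "nat \<Rightarrow> real"
    have "T \<in> measurable (Rt t) (Rt t)"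
      unfolding T_def using permutes_in_image[OF \<pi>] comp by (intro measurable_restrict) auto
    hence T: "T \<in> measurable g (Rt t)"
      using measurable_cong_sets[OF sets refl] by blast
    have "distr g (Rt t) T = g" using exch \<pi> unfolding exchangeable_def T_def by blast
    hence "M a b = (\<integral>x. f a b x \<partial>distr g (Rt t) T)" unfolding M_def by simp
    also have "\<dots> = (\<integral>x. f a b (T x) \<partial>g)"
      by (rule integral_distr[OF T f_meas[OF ab]])
    also have "\<dots> = (\<integral>x. f (\<pi> a) (\<pi> b) x \<partial>g)"
    proof -
      have "(\<Sum>c<t. (T x c)\<^sup>2) = (\<Sum>c<t. (x c)\<^sup>2)" for x
        using sum.permute[OF \<pi>, of "\<lambda>c. (x c)\<^sup>2"] unfolding T_def by (simp add: o_def)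
      thus ?thesis using ab unfolding f_def by (simp add: T_def)
    qed
    finally show ?thesis unfolding M_def by simp
  qed
  define \<alpha> \<beta> where "\<alpha> = M 0 0 - M 0 1" and "\<beta> = M 0 1"
  have M: "M a b = \<alpha> * of_bool (a = b) + \<beta>" if "a < t" "b < t" for a b
    unfolding \<alpha>_def \<beta>_def using permutation_invariant_matrix[of t M, OF _ inv that] t by simp
  have ae: "AE x in g. (\<Sum>c<t. x c) = 0 \<and> (\<exists>c<t. x c \<noteq> 0)"
    using prior unfolding is_prior_def by simp
  have "(\<Sum>a<t. M a a) = (\<integral>x. (\<Sum>a<t. f a a x) \<partial>g)"
    unfolding M_def using int by (subst Bochner_Integration.integral_sum) auto
  also have "\<dots> = (\<integral>x. 1 \<partial>g)"
  proof (rule integral_cong_AE)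
    show "(\<lambda>x. \<Sum>a<t. f a a x) \<in> borel_measurable g"
      unfolding meas using f_meas by (intro borel_measurable_sum) auto
    show "AE x in g. (\<Sum>a<t. f a a x) = 1" using ae
    proof eventually_elim
      case (elim x)
      then obtain c where c: "c < t" "x c \<noteq> 0" by blast
      hence "0 < (\<Sum>c<t. (x c)\<^sup>2)" by (intro sum_pos2[of _ c]) auto
      thus ?case unfolding f_def sum_divide_distrib[symmetric] by (simp add: power2_eq_square)
    qed
  qed simp
  finally have "real t * (\<alpha> + \<beta>) = 1" by (simp add: M prob_space)
  have "(\<Sum>a<t. \<Sum>b<t. M a b) = (\<integral>x. (\<Sum>a<t. \<Sum>b<t. f a b x) \<partial>g)"
    unfolding M_def using int
    by (subst Bochner_Integration.integral_sum)
      (auto intro!: sum.cong Bochner_Integration.integral_sum[symmetric])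
  also have "\<dots> = (\<integral>x. 0 \<partial>g)"
  proof (rule integral_cong_AE)
    show "(\<lambda>x. \<Sum>a<t. \<Sum>b<t. f a b x) \<in> borel_measurable g"
      unfolding meas using f_meas by (intro borel_measurable_sum) auto
    show "AE x in g. (\<Sum>a<t. \<Sum>b<t. f a b x) = 0" using ae
    proof eventually_elim
      case (elim x)
      thus ?case unfolding f_def sum_divide_distrib[symmetric] sum_product[symmetric] by simp
    qed
  qed simp
  finally have "(\<Sum>a<t. \<Sum>b<t. M a b) = 0" by simp
  moreover have "(\<Sum>a<t. \<Sum>b<t. M a b) = real t * (\<alpha> + real t * \<beta>)"
    by (simp add: M sum.distrib sum_distrib_left[symmetric] sum_of_bool_eq)
  ultimately have "\<alpha> + real t * \<beta> = 0" using t by simp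
  hence \<beta>: "\<beta> = - \<alpha> / real t" using t by (simp add: field_simps)
  have "real t * (\<alpha> + \<beta>) = \<alpha> * (real t - 1)"
    unfolding \<beta> using t by (simp add: field_simps)
  with \<open>real t * (\<alpha> + \<beta>) = 1\<close> have "\<alpha> * (real t - 1) = 1" by simp
  hence "\<alpha> = 1 / (real t - 1)" using t by (simp add: eq_divide_eq)
  moreover have "M a b = \<alpha> * (of_bool (a = b) - 1 / real t)"
    unfolding M[OF a b] \<beta> by (simp add: algebra_simps)
  ultimately have "M a b = (of_bool (a = b) - 1 / real t) / (real t - 1)" by simp
  thus "(\<integral>x. x a * x b / (\<Sum>c<t. (x c)\<^sup>2) \<partial>g) = (of_bool (a = b) - 1 / real t) / (real t - 1)"
    unfolding M_def f_def .
qed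

locale crossover_prior = crossover +
  fixes g :: "(nat \<Rightarrow> real) measure" and lam :: real
  assumes prior: "is_prior t g" and exch: "exchangeable t g"
begin

sublocale prob_space g using prior unfolding is_prior_def by simp

definition "info_trace P x = qC P lam - (\<Sum>a<t. (cross P lam x a)\<^sup>2) / mbil t (Cd P 2 2) x x"

abbreviation "crit P \<equiv> T_crit p t n Cov g lam P"

lemma crit_eq:
  assumes "is_design p t P"
  shows "crit P = (\<integral>x. info_trace P x \<partial>g) / (real t - 1)"
  unfolding T_crit_def Phi_T_info_mat[OF assms] info_trace_def by simp

lemma info_trace_measurable: "info_trace P \<in> borel_measurable g"
proof -
  have meas: "borel_measurable g = borel_measurable (Rt t)"
    using prior unfolding is_prior_def by (intro measurable_cong_sets) auto
  have comp: "(\<lambda>x. x c) \<in> borel_measurable (Rt t)" if "c < t" for c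
    using that by (intro measurable_component_singleton) auto
  show ?thesis unfolding meas info_trace_def cross_def mbil_def
    using comp
    by (intro borel_measurable_diff borel_measurable_divide borel_measurable_times borel_measurable_sum
        borel_measurable_power borel_measurable_const) auto
qed

lemma integrable_info_trace:
  assumes P: "is_design p t P"
  shows "integrable g (info_trace P)"
proof (rule integrable_const_bound[of _ "qC P lam"])
  have "0 \<le> info_trace P x" "info_trace P x \<le> qC P lam" for x
  proof -
    show "0 \<le> info_trace P x" unfolding info_trace_def by (rule info_trace_nonneg[OF P])
    have "0 \<le> (\<Sum>a<t. (cross P lam x a)\<^sup>2) / mbil t (Cd P 2 2) x x"
      by (intro divide_nonneg_nonneg sum_nonneg mbil_Cd22_nonneg[OF P]) auto
    thus "info_trace P x \<le> qC P lam" unfolding info_trace_def by simp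
  qed
  thus "AE x in g. norm (info_trace P x) \<le> qC P lam" by (simp add: abs_le_iff) 
qed (rule info_trace_measurable)

text \<open>Integration of the completed square with multiplier \<open>(z - lam) / |x|^2\<close>:
  after this scaling the bound depends on \<open>x\<close> only through the direction products whose
  expectations are known.\<close>

lemma crit_le:
  assumes P: "is_design p t P"
  shows "crit P \<le> ((real t - 2) * qC P lam + qC P z) / (real t - 1)\<^sup>2"
proof -
  define K where "K a b = 2 * (z - lam) * (Cd P 1 2 $$ (a,b) + lam * Cd P 2 2 $$ (a,b)) + (z - lam)\<^sup>2 * Cd P 2 2 $$ (a,b)" for a b
  define f where "f a b = (\<lambda>x :: nat \<Rightarrow> real. x a * x b / (\<Sum>c<t. (x c)\<^sup>2))" for a b
  have f_int: "integrable g (f a b)" if "a < t" "b < t" for a b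
    unfolding f_def using t prior exch that by (rule integrable_prior_direction)
  have f_val: "(\<integral>x. f a b x \<partial>g) = (of_bool (a = b) - 1 / real t) / (real t - 1)" if "a < t" "b < t" for a b
    unfolding f_def using t prior exch that by (rule integral_prior_direction)
  have le: "info_trace P x \<le> qC P lam + (\<Sum>a<t. \<Sum>b<t. K a b * f a b x)" for x
  proof -
    define N where "N = (\<Sum>c<t. (x c)\<^sup>2)"
    \<comment> \<open>Valid also for \<open>N = 0\<close>, where both sides are 0; so the bound
      holds at every \<open>x\<close>.\<close>
    have NN: "((z - lam) / N)\<^sup>2 * N = (z - lam)\<^sup>2 / N" by (simp add: power2_eq_square)
    have "info_trace P x \<le> qC P lam + 2 * ((z - lam) / N) * (\<Sum>a<t. cross P lam x a * x a) 
        + ((z - lam) / N)\<^sup>2 * N * mbil t (Cd P 2 2) x x"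
      unfolding info_trace_def N_def by (rule info_trace_le[OF P])
    also have "\<dots> = qC P lam + ((\<Sum>a<t. \<Sum>b<t. 2 * ((z - lam) / N) * ((Cd P 1 2 $$ (a,b) + lam * Cd P 2 2 $$ (a,b)) * x b * x a))
        + (\<Sum>a<t. \<Sum>b<t. (z - lam)\<^sup>2 / N * (x a * Cd P 2 2 $$ (a,b) * x b)))"
      unfolding NN cross_def mbil_def by (simp add: sum_distrib_left sum_distrib_right)
    also have "\<dots> = qC P lam + (\<Sum>a<t. \<Sum>b<t. K a b * f a b x)"
      unfolding f_def K_def N_def[symmetric] sum.distrib[symmetric]
      by (intro arg_cong[of _ _ "(+) (qC P lam)"] sum.cong refl)
        (simp add: divide_inverse algebra_simps)
    finally show ?thesis .
  qed
  have int: "integrable g (\<lambda>x. \<Sum>a<t. \<Sum>b<t. K a b * f a b x)"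
    using f_int by (intro Bochner_Integration.integrable_sum integrable_mult_right) auto
  have "(\<integral>x. info_trace P x \<partial>g) \<le> (\<integral>x. qC P lam + (\<Sum>a<t. \<Sum>b<t. K a b * f a b x) \<partial>g)"
    using le int by (intro integral_mono integrable_info_trace[OF P] Bochner_Integration.integrable_add) auto
  also have "\<dots> = qC P lam + (\<integral>x. (\<Sum>a<t. \<Sum>b<t. K a b * f a b x) \<partial>g)"
    using int by (simp add: prob_space)
  also have "(\<integral>x. (\<Sum>a<t. \<Sum>b<t. K a b * f a b x) \<partial>g) = (\<Sum>a<t. \<integral>x. (\<Sum>b<t. K a b * f a b x) \<partial>g)"
    using f_int by (intro Bochner_Integration.integral_sum Bochner_Integration.integrable_sum integrable_mult_right) auto
  also have "\<dots> = (\<Sum>a<t. \<Sum>b<t. K a b * (\<integral>x. f a b x \<partial>g))"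
    using f_int by (intro sum.cong refl, subst Bochner_Integration.integral_sum) (auto intro!: integrable_mult_right)
  also have "\<dots> = (\<Sum>a<t. \<Sum>b<t. K a b * of_bool (a = b) / (real t - 1) - K a b / (real t * (real t - 1)))"
    by (intro sum.cong refl) (simp add: f_val diff_divide_distrib right_diff_distrib)
  also have "\<dots> = (\<Sum>a<t. (\<Sum>b<t. K a b * of_bool (a = b)) / (real t - 1) - (\<Sum>b<t. K a b) / (real t * (real t - 1)))"
    by (simp only: sum_subtractf sum_divide_distrib)
  \<comment> \<open>The part \<open>- 1 / t\<close> of the expectation meets the row sums of
    \<open>K\<close>, which vanish; only the trace of \<open>K\<close> remains.\<close>
  also have "\<dots> = (\<Sum>a<t. K a a / (real t - 1))"
  proof (intro sum.cong refl)
    fix a assume "a \<in> {..<t}"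
    hence a: "a < t" by simp
    have "(\<Sum>b<t. K a b) = 2 * (z - lam) * ((\<Sum>b<t. Cd P 1 2 $$ (a,b)) + lam * (\<Sum>b<t. Cd P 2 2 $$ (a,b)))
       + (z - lam)\<^sup>2 * (\<Sum>b<t. Cd P 2 2 $$ (a,b))"
      unfolding K_def by (simp add: sum.distrib sum_distrib_left distrib_left)
    hence "(\<Sum>b<t. K a b) = 0" using C_design_row_sum[OF a] by simp
    thus "(\<Sum>b<t. K a b * of_bool (a = b)) / (real t - 1) - (\<Sum>b<t. K a b) / (real t * (real t - 1)) = K a a / (real t - 1)"
      using a by (simp add: sum_of_bool_eq)
  qed
  also have "\<dots> = (2 * (z - lam) * (trC P 1 2 + lam * trC P 2 2) + (z - lam)\<^sup>2 * trC P 2 2) / (real t - 1)"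
    unfolding sum_divide_distrib[symmetric] K_def trC_def
    by (simp add: sum.distrib sum_distrib_left distrib_left)
  finally have "(\<integral>x. info_trace P x \<partial>g) \<le> qC P lam + 
      (2 * (z - lam) * (trC P 1 2 + lam * trC P 2 2) + (z - lam)\<^sup>2 * trC P 2 2) / (real t - 1)" .
  \<comment> \<open>Taylor expansion of the parabola \<open>qC\<close> about \<open>lam\<close>; the
    multiplier was chosen to produce it.\<close>
  also have "2 * (z - lam) * (trC P 1 2 + lam * trC P 2 2) + (z - lam)\<^sup>2 * trC P 2 2 = qC P z - qC P lam"
    unfolding qC_def by (simp add: power2_eq_square algebra_simps)
  also have "qC P lam + (qC P z - qC P lam) / (real t - 1) = ((real t - 2) * qC P lam + qC P z) / (real t - 1)"
    using t by (simp add: field_simps)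
  finally have "(\<integral>x. info_trace P x \<partial>g) / (real t - 1) \<le> ((real t - 2) * qC P lam + qC P z) / (real t - 1) / (real t - 1)"
    using t by (intro divide_right_mono) simp_all
  thus ?thesis unfolding crit_eq[OF P] by (simp add: power2_eq_square)
qed

text \<open>All blocks are multiples of \<open>B_mat\<close>, which fixes vectors with coordinate
  sum 0. Hence \<open>cross\<close> is parallel to \<open>x\<close>, the loss is almost surely the
  same for every \<open>x\<close>, and it turns into \<open>q_d(lam) - q_d(x_d)\<close> by
  completing the square at the vertex.\<close>

lemma crit_balanced:
  assumes P: "is_design p t P" and bal: "balanced P"
  shows "crit P = real n * (q_design p t Cov P (x_design p t n Cov P) + (real t - 2) * q_design p t Cov P lam) / (real t - 1)\<^sup>2"
proof -
  define c where "c = c_design p t n Cov P"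
  define xd where "xd = x_design p t n Cov P"
  have c22: "0 < c 2 2" unfolding c_def by (rule c_design_22_pos[OF P])
  have c12: "c 1 2 = - xd * c 2 2" unfolding xd_def x_design_def c_def[symmetric] using c22 by simp
  have Cd: "Cd P i j $$ (a,b) = c i j / (real t - 1) * (of_bool (a = b) - 1 / real t)" 
    if "i \<in> {1,2}" "j \<in> {1,2}" "a < t" "b < t" for i j a b
    unfolding c_def using balanced_Cd[OF bal that] balanced_trC[OF bal that(1,2)] by simp
  have ae: "AE x in g. (\<Sum>c<t. x c) = 0 \<and> (\<exists>c<t. x c \<noteq> 0)"
    using prior unfolding is_prior_def by simp
  have val: "AE x in g. info_trace P x = qC P lam - (lam - xd)\<^sup>2 * c 2 2 / (real t - 1)"
    using ae
  proof eventually_elim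
    case (elim x)
    define N where "N = (\<Sum>c<t. (x c)\<^sup>2)"
    obtain k where "k < t" "x k \<noteq> 0" using elim by blast
    hence N: "0 < N" unfolding N_def by (intro sum_pos2[of _ k]) auto
    have cen: "(\<Sum>b<t. (of_bool (a = b) - 1 / real t) * x b) = x a" if "a < t" for a
    proof -
      have "(\<Sum>b<t. (of_bool (a = b) - 1 / real t) * x b) = (\<Sum>b<t. of_bool (a = b) * x b) - (\<Sum>b<t. x b) / real t"
        by (simp add: left_diff_distrib sum_subtractf sum_divide_distrib)
      thus ?thesis using elim that by (simp add: sum_of_bool_eq)
    qed
    have cr: "cross P lam x a = (lam - xd) * c 2 2 / (real t - 1) * x a" if a: "a < t" for a
    proof -
      have "cross P lam x a = (\<Sum>b<t. (lam - xd) * c 2 2 / (real t - 1) * ((of_bool (a = b) - 1 / real t) * x b))"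
        unfolding cross_def using a by (intro sum.cong refl) (simp add: Cd c12 algebra_simps diff_divide_distrib add_divide_distrib)
      also have "\<dots> = (lam - xd) * c 2 2 / (real t - 1) * x a"
        unfolding sum_distrib_left[symmetric] cen[OF a] ..
      finally show ?thesis .
    qed
    have "mbil t (Cd P 2 2) x x = (\<Sum>a<t. c 2 2 / (real t - 1) * (x a * (\<Sum>b<t. (of_bool (a = b) - 1 / real t) * x b)))"
      unfolding mbil_def sum_distrib_left by (intro sum.cong refl) (simp add: Cd)
    also have "\<dots> = c 2 2 / (real t - 1) * N"
      unfolding sum_distrib_left[symmetric] N_def
      by (intro arg_cong[of _ _ "(*) _"] sum.cong) (simp_all add: cen power2_eq_square)
    finally have quad: "mbil t (Cd P 2 2) x x = c 2 2 / (real t - 1) * N" .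
    have "(\<Sum>a<t. (cross P lam x a)\<^sup>2) = ((lam - xd) * c 2 2 / (real t - 1))\<^sup>2 * N"
      unfolding N_def sum_distrib_left by (intro sum.cong) (simp_all add: cr power_mult_distrib power_divide)
    moreover have "(A * C / d)\<^sup>2 * N / (C / d * N) = A\<^sup>2 * C / d" if "C \<noteq> 0" "d \<noteq> 0" for A C d :: real
      using that N by (simp add: power2_eq_square field_simps)
    ultimately show ?case unfolding info_trace_def quad using c22 t by simp
  qed
  have "(\<integral>x. info_trace P x \<partial>g) = (\<integral>x. qC P lam - (lam - xd)\<^sup>2 * c 2 2 / (real t - 1) \<partial>g)"
    using val by (intro integral_cong_AE info_trace_measurable) auto
  hence crit: "crit P = (qC P lam - (lam - xd)\<^sup>2 * c 2 2 / (real t - 1)) / (real t - 1)"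
    unfolding crit_eq[OF P] by (simp add: prob_space)
  have "(lam - xd)\<^sup>2 * c 2 2 = real n * q_design p t Cov P lam - real n * q_design p t Cov P xd"
    using q_design_complete_square[OF P, of lam] unfolding xd_def c_def by (simp add: mult.commute)
  thus ?thesis unfolding crit balanced_qC[OF bal] xd_def[symmetric]
    using t by (simp add: field_simps power2_eq_square)
qed

end

section \<open>Optimality\<close>

context crossover_prior
begin

definition "weight x s = q_seq p t Cov s x + (real t - 2) * q_seq p t Cov s lam"

lemma sum_weight:
  "(\<Sum>s\<in>seqs p t. P s * weight x s) = q_design p t Cov P x + (real t - 2) * q_design p t Cov P lam"
  unfolding weight_def q_design_def by (simp add: sum.distrib sum_subtractf sum_distrib_left algebra_simps)

text \<open>The linear majorant. The correction for the means may be dropped in both parabolas,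
  since the factor \<open>t - 2\<close> is nonnegative.\<close>

lemma crit_le_sum_weight:
  assumes P: "is_design p t P"
  shows "crit P \<le> real n * (\<Sum>s\<in>seqs p t. P s * weight x s) / (real t - 1)\<^sup>2"
proof -
  have "(real t - 2) * qC P lam \<le> (real t - 2) * (real n * q_design p t Cov P lam)"
    using t by (intro mult_left_mono qC_le) simp
  hence "(real t - 2) * qC P lam + qC P x \<le> real n * (\<Sum>s\<in>seqs p t. P s * weight x s)"
    unfolding sum_weight using qC_le[of P x] by (simp add: algebra_simps)
  hence "((real t - 2) * qC P lam + qC P x) / (real t - 1)\<^sup>2 \<le> real n * (\<Sum>s\<in>seqs p t. P s * weight x s) / (real t - 1)\<^sup>2"
    by (rule divide_right_mono) simp
  thus ?thesis using crit_le[OF P, of x] by linarith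
qed

text \<open>
  Moving from \<open>P\<close> a distance \<open>e\<close> towards the orbit of \<open>s\<close> keeps the design balanced, and the
  minimality of \<open>x_design\<close> for \<open>P\<close> removes the \<open>(1 - e)\<close> part of the comparison; it remains to
  let \<open>e\<close> tend to 0.
\<close>

lemma optimal_imp_weight_le:
  assumes opt: "T_optimal p t n Cov g lam P" and bal: "balanced P" and s: "s \<in> seqs p t"
  defines "x \<equiv> x_design p t n Cov P"
  shows "weight x s \<le> q_design p t Cov P x + (real t - 2) * q_design p t Cov P lam"
proof -
  define den where "den = q_design p t Cov P x + (real t - 2) * q_design p t Cov P lam"
  define U where "U = orbit_design t s"
  define Q where "Q e = (\<lambda>s. (1 - e) * P s + e * U s)" for e
  define xe where "xe e = x_design p t n Cov (Q e)" for e
  have P: "is_design p t P" using opt unfolding T_optimal_def by simp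
  have le: "weight (xe e) s \<le> den" if e: "0 < e" "e < 1" for e
  proof -
    have Qd: "is_design p t (Q e)"
      unfolding Q_def U_def using e by (intro mix_design P orbit_design_is_design[OF s]) auto
    have Qb: "balanced (Q e)"
      unfolding Q_def U_def by (intro mix_balanced bal orbit_balanced[OF s])
    have q: "q_design p t Cov (Q e) y = (1 - e) * q_design p t Cov P y + e * q_seq p t Cov s y" for y
      unfolding Q_def mix_q_design U_def orbit_q_design[OF s] ..
    have "crit (Q e) \<le> crit P" using opt Qd unfolding T_optimal_def by blast
    hence "q_design p t Cov (Q e) (xe e) + (real t - 2) * q_design p t Cov (Q e) lam \<le> den"
      unfolding crit_balanced[OF Qd Qb] crit_balanced[OF P bal] xe_def den_def x_def
      using t n by (simp add: divide_le_cancel)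
    hence "(1 - e) * (q_design p t Cov P (xe e) + (real t - 2) * q_design p t Cov P lam) + e * weight (xe e) s \<le> den"
      unfolding q weight_def by (simp add: algebra_simps)
    moreover have "(1 - e) * den \<le> (1 - e) * (q_design p t Cov P (xe e) + (real t - 2) * q_design p t Cov P lam)"
      unfolding den_def x_def using e q_design_x_design_le[OF P] by (intro mult_left_mono) auto
    ultimately have "e * weight (xe e) s \<le> e * den" by (simp add: algebra_simps)
    thus ?thesis using e by simp
  qed
  have c: "c_design p t n Cov (Q e) i j = (1 - e) * c_design p t n Cov P i j + e * c_design p t n Cov U i j" for e i j
    unfolding c_design_def Q_def by (simp add: sum.distrib sum_subtractf sum_distrib_left algebra_simps)
  \<comment> \<open>Numerator and denominator are affine in \<open>e\<close>, and at
    \<open>e = 0\<close> the denominator is the positive coefficient of \<open>P\<close>.\<close>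
  have "(xe \<longlongrightarrow> - ((1 - 0) * c_design p t n Cov P 1 2 + 0 * c_design p t n Cov U 1 2) /
      ((1 - 0) * c_design p t n Cov P 2 2 + 0 * c_design p t n Cov U 2 2)) (at_right 0)"
    unfolding xe_def x_design_def c using c_design_22_pos[OF P]
    by (intro tendsto_intros) auto
  hence "(xe \<longlongrightarrow> x) (at_right 0)" unfolding x_def x_design_def by simp
  hence "((\<lambda>e. weight (xe e) s) \<longlongrightarrow> weight x s) (at_right 0)"
    unfolding weight_def q_seq_def by (intro tendsto_intros)
  moreover have "eventually (\<lambda>e::real. weight (xe e) s \<le> den) (at_right 0)"
    by (rule eventually_mono[OF eventually_at_right_real[of 0 1]]) (auto intro: le)
  ultimately show ?thesis
    unfolding den_def[symmetric] by (rule tendsto_upperbound) simp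
qed

text \<open>The number \<open>x\<close> of the candidate is used in the majorant of every
  competitor. Averages of the weights stay below their common bound, and the criterion of
  \<open>P\<close> attains that bound.\<close>

lemma weight_le_imp_optimal:
  assumes P: "is_design p t P" and bal: "balanced P"
  defines "x \<equiv> x_design p t n Cov P"
  assumes le: "\<And>s. s \<in> seqs p t \<Longrightarrow> weight x s \<le> q_design p t Cov P x + (real t - 2) * q_design p t Cov P lam"
  shows "T_optimal p t n Cov g lam P"
proof -
  define den where "den = q_design p t Cov P x + (real t - 2) * q_design p t Cov P lam"
  have "crit P' \<le> crit P" if P': "is_design p t P'" for P'
  proof -
    have "(\<Sum>s\<in>seqs p t. P' s * weight x s) \<le> (\<Sum>s\<in>seqs p t. P' s * den)"
      using P' le unfolding is_design_def den_def by (intro sum_mono mult_left_mono) auto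
    also have "\<dots> = den" using P' unfolding is_design_def by (simp flip: sum_distrib_right)
    finally have "real n * (\<Sum>s\<in>seqs p t. P' s * weight x s) / (real t - 1)\<^sup>2 \<le> real n * den / (real t - 1)\<^sup>2"
      by (intro divide_right_mono mult_left_mono) auto
    thus ?thesis
      using crit_le_sum_weight[OF P', of x] crit_balanced[OF P bal] unfolding den_def x_def by linarith
  qed
  thus ?thesis using P unfolding T_optimal_def by blast
qed

text \<open>Provides positivity of the denominator at an optimum, where it dominates every
  weight.\<close>

lemma ex_weight_pos: "\<exists>s\<in>seqs p t. 0 < weight x s"
proof -
  obtain s where "s \<in> seqs p t" "0 < q_seq p t Cov s x" using ex_q_seq_pos by blast
  moreover have "0 \<le> (real t - 2) * q_seq p t Cov s lam"
    using t calculation(1) by (intro mult_nonneg_nonneg q_seq_nonneg) auto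
  ultimately show ?thesis unfolding weight_def by (intro bexI[of _ s]) auto
qed

text \<open>Under \<open>P\<close> the mean of the weights is \<open>den\<close>, which is also an
  upper bound for them; hence no sequence of positive mass falls short of it.\<close>

lemma weight_eq_on_support:
  assumes P: "is_design p t P"
    and le: "\<And>s. s \<in> seqs p t \<Longrightarrow> weight x s \<le> den"
    and den: "den = q_design p t Cov P x + (real t - 2) * q_design p t Cov P lam"
    and s: "s \<in> seqs p t" "P s > 0"
  shows "weight x s = den"
proof -
  have "(\<Sum>s\<in>seqs p t. P s * (den - weight x s)) = 0"
    using P unfolding right_diff_distrib sum_subtractf sum_weight den[symmetric] is_design_def
    by (simp flip: sum_distrib_right)
  moreover have "\<forall>s\<in>seqs p t. 0 \<le> P s * (den - weight x s)"
    using P le unfolding is_design_def by simp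
  ultimately have "P s * (den - weight x s) = 0" using s(1) by (simp add: sum_nonneg_eq_0_iff)
  thus ?thesis using s(2) by simp
qed

end

theorem theorem9:
  fixes p t n :: nat and Cov :: "real Matrix.mat"
    and lam :: real and g :: "(nat \<Rightarrow> real) measure" and P :: "nat list \<Rightarrow> real"
  assumes "p \<ge> 2" and "t \<ge> 2" and "n \<ge> 1"
    and "sym_pos_def p Cov"
    and "is_prior t g" and "exchangeable t g"
    and "is_design p t P" and "pseudo_symmetric p t n Cov P"
  defines "x \<equiv> x_design p t n Cov P"
  defines "num \<equiv> (\<lambda>s. q_seq p t Cov s x + (real t - 2) * q_seq p t Cov s lam)"
  defines "den \<equiv> q_design p t Cov P x + (real t - 2) * q_design p t Cov P lam"
  shows "(T_optimal p t n Cov g lam P \<longleftrightarrow>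
            den > 0 \<and> Max ((\<lambda>s. num s / den) ` seqs p t) = 1) \<and>
         (T_optimal p t n Cov g lam P \<longrightarrow>
            (\<forall>s \<in> seqs p t. P s > 0 \<longrightarrow>
               num s / den = Max ((\<lambda>s. num s / den) ` seqs p t)))"
proof -
  interpret crossover_prior p t n Cov g lam by unfold_locales fact+
  have P: "is_design p t P" by fact
  have bal: "balanced P" by (rule pseudo_symmetric_balanced) fact+
  have num: "num = weight x" unfolding num_def weight_def by auto
  let ?M = "Max ((\<lambda>s. num s / den) ` seqs p t)"
  have opt: "den > 0 \<and> ?M = 1 \<and> (\<forall>s\<in>seqs p t. P s > 0 \<longrightarrow> num s / den = ?M)"
    if "T_optimal p t n Cov g lam P"
  proof -
    have le: "num s \<le> den" if "s \<in> seqs p t" for s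
      unfolding num den_def x_def
      using optimal_imp_weight_le[OF \<open>T_optimal p t n Cov g lam P\<close> bal that] .
    have pos: "den > 0" using ex_weight_pos[of x] le unfolding num by force
    have eq: "num s = den" if "s \<in> seqs p t" "P s > 0" for s
      unfolding num using P le that by (intro weight_eq_on_support) (simp_all add: num den_def)
    obtain s where s: "s \<in> seqs p t" "P s > 0"
    proof -
      have "\<exists>s\<in>seqs p t. P s \<noteq> 0"
      proof (rule ccontr)
        assume "\<not> ?thesis"
        hence "(\<Sum>s\<in>seqs p t. P s) = 0" by simp
        thus False using P unfolding is_design_def by simp
      qed
      thus thesis using that P unfolding is_design_def by force
    qed
    have M: "?M = 1"
    proof (rule Max_eqI)
      show "y \<le> 1" if "y \<in> (\<lambda>s. num s / den) ` seqs p t" for y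
        using that le pos by auto
      show "1 \<in> (\<lambda>s. num s / den) ` seqs p t"
        using s eq[OF s] pos by (auto intro!: image_eqI[of _ _ s])
    qed simp
    show ?thesis using pos M eq by auto
  qed
  have "T_optimal p t n Cov g lam P" if "den > 0" "?M = 1"
  proof (rule weight_le_imp_optimal[OF P bal])
    fix s assume s: "s \<in> seqs p t"
    have "num s / den \<le> ?M" using s by (intro Max_ge) auto
    hence "num s \<le> den" using that by (simp add: divide_le_eq)
    thus "weight (x_design p t n Cov P) s \<le> q_design p t Cov P (x_design p t n Cov P) + (real t - 2) * q_design p t Cov P lam"
      unfolding num den_def x_def .
  qed
  thus ?thesis using opt by blast
qed

end
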